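(* Let $n$ and $r$ be positive integers with $n\equiv 3\pmod{4}$. Then, modulo $\Phi_{n^{2r}}(q)^2\prod_{j=1}^{r}\Phi_{n^{2j-1}}(q)^2$, \[ \sum_{k=0}^{(n^{2r}-1)/2}\frac{(1+q^{4k+1})(q^2;q^4)_k^3}{(1+q)(q^4;q^4)_k^3}q^k \equiv \frac{[n^{2r}]_{q^2}(q^3;q^4)_{(n^{2r}-1)/2}}{(q^5;q^4)_{(n^{2r}-1)/2}}\, q^{(1-n^{2r})/2}, \] and \[ \sum_{k=0}^{n^{2r}-1}\frac{(1+q^{4k+1})(q^2;q^4)_k^3}{(1+q)(q^4;q^4)_k^3}q^k \equiv \frac{[n^{2r}]_{q^2}(q^3;q^4)_{(n^{2r}-1)/2}}{(q^5;q^4)_{(n^{2r}-1)/2}}\, q^{(1-n^{2r})/2}. \]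
   Context: The $q$-shifted factorial is $(a;q)_0=1$ and $(a;q)_k=(1-a)(1-aq)\cdots(1-aq^{k-1})$ for $k\geqslant 1$. The $q$-integer is $[N]_q=1+q+\cdots+q^{N-1}$, so $[N]_{q^2}=1+q^2+\cdots+q^{2(N-1)}$. $\Phi_N(q)$ denotes the $N$-th cyclotomic polynomial. For rational functions $A(q),B(q)$, $A(q)\equiv B(q)\pmod{P(q)}$ means that $A(q)-B(q)=P(q)\,U(q)/V(q)$ with polynomials $U,V$ and $V(q)$ relatively prime to $P(q)$. *)

theory Defs
  imports
    "HOL-Computational_Algebra.Computational_Algebra"
    "HOL-Number_Theory.Cong"
    Complex_Main
begin

definition qpoch :: "'a::comm_ring_1 \<Rightarrow> 'a \<Rightarrow> nat \<Rightarrow> 'a" where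
  "qpoch a q k = (\<Prod>i<k. 1 - a * q ^ i)"

definition qint :: "'a::comm_ring_1 \<Rightarrow> nat \<Rightarrow> 'a" where
  "qint q N = (\<Sum>i<N. q ^ i)"

text \<open>
  The recursion is \<open>X^N - 1 = (\<Prod>d | d dvd N. cyclotomic d)\<close> solved for the factor with
  \<open>d = N\<close>. The division is exact, and for \<open>N > 0\<close> the result is the product of \<open>X - \<zeta>\<close> over the
  primitive \<open>N\<close>-th roots of unity \<open>\<zeta>\<close>, see \<open>map_poly_cyclotomic\<close> below.
\<close>
fun cyclotomic :: "nat \<Rightarrow> rat poly" where
  "cyclotomic N = (monom 1 N - 1) div (\<Prod>d\<in>{d. d dvd N \<and> d < N}. cyclotomic d)"

declare cyclotomic.simps [simp del]

text \<open>Rational functions in \<open>q\<close> are elements of the fraction field of \<open>\<rat>[q]\<close>.\<close>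
type_synonym ratfun = "rat poly fract"

definition qvar :: ratfun where
  "qvar = to_fract [:0, 1:]"

definition ratfun_cong :: "ratfun \<Rightarrow> ratfun \<Rightarrow> rat poly \<Rightarrow> bool" where
  "ratfun_cong A B P \<longleftrightarrow>
     (\<exists>U V. V \<noteq> 0 \<and> coprime V P \<and> A - B = to_fract P * (to_fract U / to_fract V))"


definition unity_root :: "nat \<Rightarrow> nat \<Rightarrow> complex" where
  "unity_root N k = cis (2 * pi * real k / real N)"

lemma X_pow_minus_1_eq_prod:
  assumes "N > 0"
  shows "monom 1 N - 1 = (\<Prod>k\<in>{1..N}. [:- unity_root N k, 1:])"
proof -
  let ?p = "monom 1 N - 1 :: complex poly"
  let ?q = "\<Prod>k\<in>{1..N}. [:- unity_root N k, 1:]"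
  have root: "unity_root N k ^ N = 1" for k
  proof -
    have "unity_root N k ^ N = cis (2 * pi * real k)"
      using assms by (simp add: unity_root_def DeMoivre)
    also have "\<dots> = cis (2 * pi) ^ k"
      by (simp add: DeMoivre mult_ac del: cis_2pi)
    finally show ?thesis by simp
  qed
  have shift: "unity_root N N = unity_root N 0"
    using assms by (simp add: unity_root_def)
  have inj0: "inj_on (unity_root N) {..<N}"
    using bij_betw_roots_unity[OF assms] by (simp add: bij_betw_def unity_root_def [abs_def])
  have inj: "inj_on (unity_root N) {1..N}"
  proof (rule inj_onI)
    fix j k assume jk: "j \<in> {1..N}" "k \<in> {1..N}" "unity_root N j = unity_root N k"
    define f where "f = (\<lambda>i. if i = N then 0 else i)"
    have "unity_root N (f j) = unity_root N (f k)"
      using jk shift by (auto simp: f_def)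
    moreover have "f j \<in> {..<N}" "f k \<in> {..<N}"
      using jk by (auto simp: f_def)
    ultimately have "f j = f k"
      using inj0 by (auto dest: inj_onD)
    then show "j = k" using jk by (auto simp: f_def split: if_splits)
  qed
  have degq: "degree ?q = N"
    by (simp add: degree_prod_eq_sum_degree)
  have lcq: "lead_coeff ?q = 1"
    unfolding lead_coeff_prod by simp
  have degp: "degree (?p - ?q) < N"
  proof -
    have c: "coeff (?p - ?q) N = 0"
    proof -
      have "coeff ?q N = 1" using lcq unfolding degq .
      moreover have "coeff ?p N = 1" using assms by (simp add: coeff_1)
      ultimately show ?thesis by (simp only: coeff_diff diff_self)
    qed
    have le: "degree (?p - ?q) \<le> N"
    proof (rule degree_diff_le)
      show "degree ?p \<le> N"
        by (intro degree_diff_le degree_monom_le) simp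
    qed (use degq in simp)
    show ?thesis
    proof (rule ccontr)
      assume "\<not> ?thesis"
      with le have "degree (?p - ?q) = N" by simp
      with c have "?p - ?q = 0" by (metis leading_coeff_0_iff)
      then have "degree (?p - ?q) = 0" by (simp only: degree_0)
      with \<open>degree (?p - ?q) = N\<close> assms show False by simp
    qed
  qed
  have "?p - ?q = 0"
  proof (rule ccontr)
    assume nz: "?p - ?q \<noteq> 0"
    have sub: "unity_root N ` {1..N} \<subseteq> {x. poly (?p - ?q) x = 0}"
    proof
      fix x assume "x \<in> unity_root N ` {1..N}"
      then obtain k where k: "k \<in> {1..N}" "x = unity_root N k" by auto
      have "poly ?p x = 0" by (simp add: k root poly_monom)
      moreover have "poly ?q x = 0" using k by (auto simp: poly_prod)
      ultimately show "x \<in> {x. poly (?p - ?q) x = 0}" by simp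
    qed
    have "N = card (unity_root N ` {1..N})" using inj by (simp add: card_image)
    also have "\<dots> \<le> card {x. poly (?p - ?q) x = 0}"
      using sub nz by (intro card_mono poly_roots_finite)
    also have "\<dots> \<le> degree (?p - ?q)" by (rule card_poly_roots_bound[OF nz])
    finally show False using degp by simp
  qed
  then show ?thesis by simp
qed

lemma X_pow_minus_1_eq_prod_primitive:
  assumes "N > 0"
  shows "monom 1 N - 1 =
    (\<Prod>d\<in>{d. d dvd N}. \<Prod>k | k \<in> {1..d} \<and> coprime k d. [:- unity_root d k, 1:])"
proof -
  let ?S = "SIGMA d:{d. d dvd N}. {k. k \<in> {1..d} \<and> coprime k d}"
  have "(\<Prod>d\<in>{d. d dvd N}. \<Prod>k | k \<in> {1..d} \<and> coprime k d. [:- unity_root d k, 1:])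
      = (\<Prod>(d, k)\<in>?S. [:- unity_root d k, 1:])"
    using assms by (subst prod.Sigma) (auto intro: finite_divisors_nat)
  also have "\<dots> = (\<Prod>k\<in>{1..N}. [:- unity_root N k, 1:])"
  proof (rule prod.reindex_bij_witness[where
        i = "\<lambda>k. (N div gcd k N, k div gcd k N)" and j = "\<lambda>(d, k). k * (N div d)"])
    fix a assume "a \<in> ?S"
    then obtain d k where a: "a = (d, k)" "d dvd N" "1 \<le> k" "k \<le> d" "coprime k d" by auto
    then obtain e where e: "N = d * e" by auto
    with assms have pos: "d > 0" "e > 0" by auto
    have g: "gcd (k * e) (d * e) = e"
      using a by (metis coprime_imp_gcd_eq_1 gcd_mult_distrib_nat mult.commute mult.right_neutral)
    show "(N div gcd (case a of (d, k) \<Rightarrow> k * (N div d)) N,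
           (case a of (d, k) \<Rightarrow> k * (N div d)) div gcd (case a of (d, k) \<Rightarrow> k * (N div d)) N) = a"
      using a e pos g by simp
    show "(case a of (d, k) \<Rightarrow> k * (N div d)) \<in> {1..N}"
      using a e pos by simp
    show "[:- unity_root N (case a of (d, k) \<Rightarrow> k * (N div d)), 1:]
        = (case a of (d, k) \<Rightarrow> [:- unity_root d k, 1:])"
      using a e pos by (simp add: unity_root_def mult.assoc)
  next
    fix k assume k: "k \<in> {1..N}"
    have nz: "gcd k N > 0" using k by simp
    have le: "k div gcd k N \<le> N div gcd k N" using k by (intro div_le_mono) simp
    have pos: "1 \<le> k div gcd k N"
      using k by (metis Suc_leI One_nat_def atLeastAtMost_iff div_greater_zero_iff gcd_le1_nat
          not_one_le_zero nz)
    have cop: "coprime (k div gcd k N) (N div gcd k N)"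
      using k by (intro div_gcd_coprime) auto
    have "N div (N div gcd k N) = gcd k N"
      using assms by (metis div_mult_self1_is_m dvd_mult_div_cancel gcd_dvd2 
          mult.commute dvd_div_eq_0_iff gr0I)
    then show "(case (N div gcd k N, k div gcd k N) of (d, k) \<Rightarrow> k * (N div d)) = k"
      by simp
    have "N div gcd k N dvd N"
      by (metis dvd_mult_div_cancel dvd_triv_right gcd_dvd2)
    then show "(N div gcd k N, k div gcd k N) \<in> ?S"
      using le pos cop by auto
  qed
  finally show ?thesis using X_pow_minus_1_eq_prod[OF assms] by simp
qed

lemma map_poly_of_rat_mult:
  "map_poly (of_rat :: rat \<Rightarrow> complex) (p * q) = map_poly of_rat p * map_poly of_rat q"
  by (rule poly_eqI) (simp add: coeff_map_poly coeff_mult of_rat_sum of_rat_mult)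

lemma map_poly_of_rat_add:
  "map_poly (of_rat :: rat \<Rightarrow> complex) (p + q) = map_poly of_rat p + map_poly of_rat q"
  by (rule poly_eqI) (simp add: coeff_map_poly of_rat_add)

lemma map_poly_of_rat_prod:
  "map_poly (of_rat :: rat \<Rightarrow> complex) (\<Prod>x\<in>A. f x) = (\<Prod>x\<in>A. map_poly of_rat (f x))"
  by (induction A rule: infinite_finite_induct) (simp_all add: map_poly_of_rat_mult map_poly_1)

theorem map_poly_cyclotomic:
  assumes "N > 0"
  shows "map_poly of_rat (cyclotomic N)
    = (\<Prod>k | k \<in> {1..N} \<and> coprime k N. [:- cis (2 * pi * real k / real N), 1:])"
  using assms
proof (induction N rule: less_induct)
  case (less N)
  let ?h = "map_poly (of_rat :: rat \<Rightarrow> complex)"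
  let ?C = "\<lambda>d. \<Prod>k | k \<in> {1..d} \<and> coprime k d. [:- unity_root d k, 1:]"
  let ?D = "{d. d dvd N \<and> d < N}"
  define A :: "rat poly" where "A = monom 1 N - 1"
  define B where "B = (\<Prod>d\<in>?D. cyclotomic d)"
  have deg: "degree (?h p) = degree p" for p by (rule degree_map_poly) simp
  have fin: "finite ?D" by simp
  have hB: "?h B = (\<Prod>d\<in>?D. ?C d)"
    unfolding B_def map_poly_of_rat_prod unity_root_def
    by (intro prod.cong refl less.IH) (use less.prems in \<open>auto intro: Nat.gr0I\<close>)
  have nzB: "?h B \<noteq> 0" unfolding hB using fin by (auto simp: prod_zero_iff)
  have "?h A = monom 1 N - 1"
    by (rule poly_eqI) (simp add: A_def coeff_map_poly of_rat_diff coeff_1)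
  also have "\<dots> = (\<Prod>d\<in>insert N ?D. ?C d)"
    unfolding X_pow_minus_1_eq_prod_primitive[OF less.prems]
    by (rule prod.cong) (use less.prems in \<open>auto dest: dvd_imp_le simp: le_less\<close>)
  also have "\<dots> = ?h B * ?C N"
    unfolding hB using fin by (subst prod.insert) (auto simp: mult.commute)
  finally have hA: "?h A = ?h B * ?C N" .
  have "?h A = ?h (B * (A div B) + A mod B)" by simp
  then have "?h A = ?h B * ?h (A div B) + ?h (A mod B)"
    by (simp only: map_poly_of_rat_mult map_poly_of_rat_add)
  with hA have eq: "?h B * (?C N - ?h (A div B)) = ?h (A mod B)"
    by (simp add: algebra_simps)
  have "?C N - ?h (A div B) = 0"
  proof (rule ccontr)
    assume nz: "?C N - ?h (A div B) \<noteq> 0"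
    with nzB eq have "?h (A mod B) \<noteq> 0" by auto
    then have "A mod B \<noteq> 0" by auto
    moreover have "B \<noteq> 0" using nzB by auto
    ultimately have "degree (A mod B) < degree B" using degree_mod_less by blast
    moreover have "degree (A mod B) = degree B + degree (?C N - ?h (A div B))"
      using degree_mult_eq[OF nzB nz] unfolding eq deg .
    ultimately show False by simp
  qed
  moreover have "cyclotomic N = A div B"
    by (simp add: cyclotomic.simps[of N] A_def B_def)
  ultimately show ?case by (simp add: unity_root_def)
qed

end

theory Submission
  imports Defs "HOL-Computational_Algebra.Field_as_Ring"
begin

text \<open>
  Let \<open>M\<close> be odd and split the summation range into blocks \<open>k = M l + s\<close> with \<open>0 \<le> s < M\<close>. Up to a
  factor that is integral at \<open>\<Phi>\<^sub>M\<close>, the summands of a block are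
  \<open>(1 + z q^(4s+1)) ((z q^2; q^4)\<^sub>s / (z q^4; q^4)\<^sub>s)^3 q^s\<close> with \<open>z = q^(4Ml)\<close>, and those with
  \<open>s > (M - 1) / 2\<close> vanish modulo \<open>\<Phi>\<^sub>M^3\<close>. If \<open>v\<^sub>1 v\<^sub>2 v\<^sub>3 = 1\<close> and all \<open>v\<^sub>i\<close> are congruent to 1 modulo
  \<open>\<Phi>\<^sub>M\<close>, then \<open>(1 - x)^3\<close> and \<open>(1 - x v\<^sub>1) (1 - x v\<^sub>2) (1 - x v\<^sub>3)\<close> agree modulo \<open>\<Phi>\<^sub>M^2\<close>, since the
  first-order terms cancel. Choosing \<open>v = (z, q^(-2M) / z, q^(2M))\<close> in the numerators and the inverses in
  the denominators turns the block into a terminating very-well-poised \<open>6\<phi>5\<close> series, which is summable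
  in closed form. For \<open>M = n^(2r)\<close>, \<open>l = 0\<close> the closed form is the right-hand side of the theorem; for
  \<open>M\<close> congruent to 3 modulo 4 it is divisible by \<open>\<Phi>\<^sub>M^2\<close>, and so is the right-hand side.
\<close>

section \<open>Cyclotomic polynomials and their local rings\<close>

text \<open>A nonconstant common divisor would have a complex root by the fundamental theorem of
  algebra. This reduces the coprimality facts below to a comparison of complex roots.\<close>

lemma coprime_poly_if_no_common_root:
  fixes p q :: "rat poly"
  assumes "p \<noteq> 0" and "\<And>z :: complex. poly (map_poly of_rat p) z = 0 \<Longrightarrow> poly (map_poly of_rat q) z = 0 \<Longrightarrow> False"
  shows "coprime p q"
proof (rule coprimeI)
  fix g assume g: "g dvd p" "g dvd q"
  have "degree (map_poly (of_rat :: rat \<Rightarrow> complex) g) = 0"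
  proof (rule ccontr)
    assume "\<not> ?thesis"
    then obtain z :: complex where "poly (map_poly of_rat g) z = 0"
      using fundamental_theorem_of_algebra by (metis constant_degree)
    with g have "poly (map_poly of_rat p) z = 0" "poly (map_poly of_rat q) z = 0"
      by (auto simp: map_poly_of_rat_mult elim!: dvdE)
    with assms(2) show False .
  qed
  then have "degree g = 0" by (subst (asm) degree_map_poly) auto
  moreover have "g \<noteq> 0" using g assms(1) by auto
  ultimately show "is_unit g" by (simp add: is_unit_iff_degree)
qed

lemma map_poly_of_rat_inject:
  "map_poly (of_rat :: rat \<Rightarrow> complex) p = map_poly of_rat q \<longleftrightarrow> p = q"
  by (auto simp: poly_eq_iff coeff_map_poly)

lemma map_poly_of_rat_X_pow_minus_1:
  "map_poly (of_rat :: rat \<Rightarrow> complex) (monom 1 N - 1) = monom 1 N - 1"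
  by (rule poly_eqI) (simp add: coeff_map_poly of_rat_diff coeff_1)

text \<open>The factorisation of \<open>monom 1 N - 1\<close> over the complex numbers descends to
  the rationals because coefficientwise \<open>of_rat\<close> is injective.\<close>

lemma cyclotomic_dvd:
  assumes "N > 0" "M dvd N"
  shows "cyclotomic M dvd monom 1 N - 1"
proof -
  have pos: "d > 0" if "d dvd N" for d using assms that by (auto intro: Nat.gr0I)
  have "map_poly (of_rat :: rat \<Rightarrow> complex) (monom 1 N - 1) = map_poly of_rat (\<Prod>d | d dvd N. cyclotomic d)"
    unfolding map_poly_of_rat_X_pow_minus_1 X_pow_minus_1_eq_prod_primitive[OF assms(1)] map_poly_of_rat_prod
    by (intro prod.cong refl) (use pos in \<open>simp add: map_poly_cyclotomic unity_root_def\<close>)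
  then have "monom 1 N - 1 = (\<Prod>d | d dvd N. cyclotomic d)"
    by (simp only: map_poly_of_rat_inject)
  then show ?thesis using assms by (simp add: dvd_prodI finite_divisors_nat)
qed

lemma cis_power_eq_1_iff:
  assumes "N > 0" "coprime k N"
  shows "cis (2 * pi * real k / real N) ^ j = 1 \<longleftrightarrow> N dvd j"
proof
  assume "N dvd j"
  then obtain i where "j = N * i" by auto
  then have "cis (2 * pi * real k / real N) ^ j = cis (2 * pi) ^ (k * i)"
    using assms by (simp add: DeMoivre mult_ac del: cis_2pi)
  then show "cis (2 * pi * real k / real N) ^ j = 1" by simp
next
  assume "cis (2 * pi * real k / real N) ^ j = 1"
  then have "cos (real j * (2 * pi * real k / real N)) = 1"
    by (simp add: DeMoivre complex_eq_iff)
  then obtain i :: int where "real j * (2 * pi * real k / real N) = real_of_int i * 2 * pi"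
    using cos_one_2pi_int by blast
  then have "real j * real k = real_of_int i * real N"
    using assms by (simp add: field_simps)
  then have "int j * int k = i * int N"
    by (metis of_int_eq_iff of_int_mult of_int_of_nat_eq)
  then have "int N dvd int (j * k)" by simp
  then have "N dvd j * k" by presburger
  then show "N dvd j" using assms(2) by (simp add: coprime_commute coprime_dvd_mult_left_iff)
qed

text \<open>The roots are primitive \<open>N\<close>-th roots of unity. The coprimality statements
  that follow all come from evaluating at such a root.\<close>

lemma cyclotomic_root_order:
  assumes "N > 0" "poly (map_poly of_rat (cyclotomic N)) z = (0 :: complex)"
  shows "z ^ j = 1 \<longleftrightarrow> N dvd j"
proof -
  obtain k where "coprime k N" "z = cis (2 * pi * real k / real N)"
    using assms by (auto simp: map_poly_cyclotomic poly_prod prod_zero_iff)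
  then show ?thesis using cis_power_eq_1_iff[OF assms(1)] by simp
qed

lemma cyclotomic_nonzero: "N > 0 \<Longrightarrow> cyclotomic N \<noteq> 0"
  using map_poly_cyclotomic[of N] by (auto simp: prod_zero_iff)

lemma coprime_cyclotomic:
  assumes "M > 0" "N > 0" "M \<noteq> N"
  shows "coprime (cyclotomic M) (cyclotomic N)"
proof (rule coprime_poly_if_no_common_root)
  fix z :: complex
  assume "poly (map_poly of_rat (cyclotomic M)) z = 0" "poly (map_poly of_rat (cyclotomic N)) z = 0"
  then have "M dvd j \<longleftrightarrow> N dvd j" for j using cyclotomic_root_order assms by metis
  then show False using assms(3) by (metis dvd_antisym dvd_refl)
qed (use assms cyclotomic_nonzero in auto)

lemma coprime_cyclotomic_X_pow_minus_1:
  assumes "N > 0" "\<not> N dvd j"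
  shows "coprime (monom 1 j - 1) (cyclotomic N)"
  unfolding coprime_commute[of "monom 1 j - 1"]
proof (rule coprime_poly_if_no_common_root)
  fix z :: complex
  assume "poly (map_poly of_rat (cyclotomic N)) z = 0" "poly (map_poly of_rat (monom 1 j - 1)) z = 0"
  then show False using cyclotomic_root_order assms
    by (auto simp: map_poly_of_rat_X_pow_minus_1 poly_monom)
qed (use assms cyclotomic_nonzero in auto)

lemma coprime_cyclotomic_X:
  assumes "N > 0"
  shows "coprime [:0, 1:] (cyclotomic N)"
  unfolding coprime_commute[of "[:0, 1:]"]
proof (rule coprime_poly_if_no_common_root)
  fix z :: complex
  assume "poly (map_poly of_rat (cyclotomic N)) z = 0" "poly (map_poly of_rat [:0, 1:]) z = 0"
  then have "z ^ N = 1" "z = 0" using cyclotomic_root_order assms by (auto simp: map_poly_pCons)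
  then show False using assms by (simp add: power_0_left)
qed (use assms cyclotomic_nonzero in auto)

text \<open>On the roots of \<open>cyclotomic N\<close> this polynomial takes the value \<open>d\<close>.\<close>
lemma coprime_cyclotomic_geometric_sum:
  assumes "N > 0" "d > 0"
  shows "coprime (\<Sum>i<d. monom 1 (N * i)) (cyclotomic N)"
  unfolding coprime_commute[of "sum _ _"]
proof (rule coprime_poly_if_no_common_root)
  fix z :: complex
  assume z: "poly (map_poly of_rat (cyclotomic N)) z = 0" "poly (map_poly of_rat (\<Sum>i<d. monom 1 (N * i))) z = 0"
  have "map_poly of_rat (\<Sum>i<d. monom 1 (N * i)) = (\<Sum>i<d. monom 1 (N * i) :: complex poly)"
    by (rule poly_eqI) (auto simp: coeff_map_poly coeff_sum of_rat_sum intro!: sum.cong)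
  moreover have "z ^ (N * i) = 1" for i using cyclotomic_root_order[OF assms(1) z(1)] by simp
  ultimately show False using z(2) assms by (simp add: poly_sum poly_monom)
qed (use assms cyclotomic_nonzero in auto)

section \<open>The local ring at a polynomial and the powers of its ideal\<close>

lemma to_fract_power: "to_fract (p ^ k) = to_fract p ^ k"
  by (induction k) simp_all

text \<open>The localisation of \<rat>[q] at the multiplicative set of nonzero polynomials coprime
  to \<open>P\<close>.\<close>

definition loc :: "rat poly \<Rightarrow> ratfun set" where
  "loc P = {to_fract U / to_fract V | U V. V \<noteq> 0 \<and> coprime V P}"

lemma locI: "V \<noteq> 0 \<Longrightarrow> coprime V P \<Longrightarrow> to_fract U / to_fract V \<in> loc P"
  by (auto simp: loc_def)

lemma loc_to_fract: "to_fract U \<in> loc P"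
  using locI[of 1 P U] by simp

lemma loc_0: "0 \<in> loc P" and loc_1: "1 \<in> loc P"
  using loc_to_fract[of 0 P] loc_to_fract[of 1 P] by simp_all

lemma loc_mult: assumes "f \<in> loc P" "g \<in> loc P" shows "f * g \<in> loc P"
proof -
  obtain U V U' V' where "f = to_fract U / to_fract V" "V \<noteq> 0" "coprime V P"
    "g = to_fract U' / to_fract V'" "V' \<noteq> 0" "coprime V' P" using assms by (auto simp: loc_def)
  then show ?thesis using locI[of "V * V'" P "U * U'"] by (simp add: coprime_mult_left_iff)
qed

lemma loc_add: assumes "f \<in> loc P" "g \<in> loc P" shows "f + g \<in> loc P"
proof -
  obtain U V U' V' where "f = to_fract U / to_fract V" "V \<noteq> 0" "coprime V P"
    "g = to_fract U' / to_fract V'" "V' \<noteq> 0" "coprime V' P" using assms by (auto simp: loc_def)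
  then show ?thesis using locI[of "V * V'" P "U * V' + U' * V"]
    by (simp add: coprime_mult_left_iff add_frac_eq)
qed

lemma loc_uminus: "f \<in> loc P \<Longrightarrow> - f \<in> loc P"
  using loc_mult[OF loc_to_fract[of "-1"], of f P] by simp

lemma loc_diff: "f \<in> loc P \<Longrightarrow> g \<in> loc P \<Longrightarrow> f - g \<in> loc P"
  using loc_add[of f P "-g"] loc_uminus by simp

lemma loc_power: "f \<in> loc P \<Longrightarrow> f ^ k \<in> loc P"
  by (induction k) (auto intro: loc_mult loc_1)

lemma loc_prod: "(\<And>i. i \<in> A \<Longrightarrow> f i \<in> loc P) \<Longrightarrow> prod f A \<in> loc P"
  by (induction A rule: infinite_finite_induct) (auto intro: loc_mult loc_1)

text \<open>The \<open>k\<close>-th power of the principal ideal of \<open>P\<close> in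
  \<open>loc P\<close>. For \<open>k > 0\<close>, \<open>A - B \<in> ideal P k\<close> is congruence
  modulo \<open>P ^ k\<close>.\<close>

definition ideal :: "rat poly \<Rightarrow> nat \<Rightarrow> ratfun set" where
  "ideal P k = {to_fract P ^ k * w | w. w \<in> loc P}"

lemma idealI: "w \<in> loc P \<Longrightarrow> f = to_fract P ^ k * w \<Longrightarrow> f \<in> ideal P k"
  by (auto simp: ideal_def)

lemma ideal_0: "0 \<in> ideal P k"
  by (rule idealI[OF loc_0]) simp

lemma ideal_add: "f \<in> ideal P k \<Longrightarrow> g \<in> ideal P k \<Longrightarrow> f + g \<in> ideal P k"
  by (auto simp: ideal_def simp flip: distrib_left intro!: loc_add)

lemma ideal_mult:
  assumes "f \<in> ideal P j" "g \<in> ideal P k"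
  shows "f * g \<in> ideal P (j + k)"
proof -
  obtain v w where "v \<in> loc P" "f = to_fract P ^ j * v" "w \<in> loc P" "g = to_fract P ^ k * w"
    using assms by (auto simp: ideal_def)
  then show ?thesis by (intro idealI[of "v * w"] loc_mult) (simp_all add: power_add)
qed

lemma ideal_zero_eq_loc: "ideal P 0 = loc P"
  by (auto simp: ideal_def)

lemma ideal_mult_loc: "f \<in> ideal P k \<Longrightarrow> g \<in> loc P \<Longrightarrow> f * g \<in> ideal P k"
  using ideal_mult[of f P k g 0] by (simp add: ideal_zero_eq_loc)

lemma loc_mult_ideal: "f \<in> loc P \<Longrightarrow> g \<in> ideal P k \<Longrightarrow> f * g \<in> ideal P k"
  using ideal_mult_loc[of g P k f] by (simp add: mult.commute)

lemma ideal_uminus: "f \<in> ideal P k \<Longrightarrow> - f \<in> ideal P k"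
  using loc_mult_ideal[OF loc_uminus[OF loc_1], of f P k] by simp

lemma ideal_diff: "f \<in> ideal P k \<Longrightarrow> g \<in> ideal P k \<Longrightarrow> f - g \<in> ideal P k"
  using ideal_add[of f P k "-g"] ideal_uminus by simp

lemma ideal_sum: "(\<And>i. i \<in> A \<Longrightarrow> f i \<in> ideal P k) \<Longrightarrow> sum f A \<in> ideal P k"
  by (induction A rule: infinite_finite_induct) (auto intro: ideal_add ideal_0)

text \<open>If \<open>A - B\<close> is written in lowest terms, each modulus divides its numerator.\<close>
lemma ratfun_cong_prodI:
  assumes "finite D" and coprime: "\<And>d e. d \<in> D \<Longrightarrow> e \<in> D \<Longrightarrow> d \<noteq> e \<Longrightarrow> coprime (P d) (P e)"
    and ideal: "\<And>d. d \<in> D \<Longrightarrow> A - B \<in> ideal (P d) k"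
  shows "ratfun_cong A B (\<Prod>d\<in>D. P d ^ k)"
proof -
  define U V where "U = fst (quot_of_fract (A - B))" and "V = snd (quot_of_fract (A - B))"
  have UV: "coprime U V" "V \<noteq> 0" "A - B = to_fract U / to_fract V"
    unfolding U_def V_def Fract_conv_to_fract[symmetric] Fract_quot_of_fract
    by (simp_all add: coprime_quot_of_fract)
  have dvd: "P d ^ k dvd U" if dD: "d \<in> D" for d
  proof -
    obtain w where w: "w \<in> loc (P d)" "A - B = to_fract (P d) ^ k * w"
      using ideal[OF dD] by (auto simp: ideal_def)
    obtain U' V' where "V' \<noteq> 0" "coprime V' (P d)" "w = to_fract U' / to_fract V'"
      using w(1) by (auto simp: loc_def)
    with w(2) have *: "V' \<noteq> 0" "coprime V' (P d)"
      "A - B = to_fract (P d ^ k) * to_fract U' / to_fract V'"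
      by (simp_all add: to_fract_power)
    then have "to_fract (U * V') = to_fract (P d ^ k * U' * V)"
      using UV by (simp add: field_simps)
    then have "U * V' = P d ^ k * U' * V" by (simp only: to_fract_eq_iff)
    then have "P d ^ k dvd U * V'" by simp
    then show ?thesis using *(2) by (metis coprime_commute coprime_dvd_mult_left_iff coprime_power_left_iff)
  qed
  have "(\<Prod>d\<in>D. P d ^ k) dvd U"
    using assms(1) coprime dvd
  proof (induction D rule: finite_induct)
    case (insert d D)
    then have "coprime (P d ^ k) (\<Prod>d\<in>D. P d ^ k)"
      by (intro prod_coprime_right) (metis coprime_power_left_iff coprime_power_right_iff insertCI)
    with insert show ?case by (simp add: divides_mult)
  qed simp
  then obtain W where W: "U = (\<Prod>d\<in>D. P d ^ k) * W" by auto
  \<comment> \<open>The product divides \<open>U\<close>, which is coprime to the reduced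
    denominator \<open>V\<close>.\<close>
  have "coprime V (\<Prod>d\<in>D. P d ^ k)"
    using UV(1) W by (metis coprime_commute coprime_mult_left_iff)
  then show ?thesis unfolding ratfun_cong_def using UV W by auto
qed

section \<open>The terminating very-well-poised 6phi5 sum\<close>

lemma qpoch_0 [simp]: "qpoch a q 0 = 1"
  by (simp add: qpoch_def)

lemma qpoch_Suc: "qpoch a q (Suc k) = qpoch a q k * (1 - a * q ^ k)"
  by (simp add: qpoch_def)

lemma qpoch_Suc_shift: "qpoch a q (Suc k) = (1 - a) * qpoch (a * q) q k"
  unfolding qpoch_def prod.lessThan_Suc_shift by (simp add: mult.assoc)

text \<open>Term \<open>k\<close> of the very-well-poised 6phi5 series with parameters
  \<open>a\<close>, \<open>b\<close>, \<open>c\<close>, \<open>1 / q ^ m\<close>. The parameters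
  involving the square root of \<open>a\<close> combine into
  \<open>(1 - a * q ^ (2 * k)) / (1 - a)\<close>, so no root has to exist in the field.\<close>

definition vwp_term :: "'a::field \<Rightarrow> 'a \<Rightarrow> 'a \<Rightarrow> 'a \<Rightarrow> nat \<Rightarrow> nat \<Rightarrow> 'a" where
  "vwp_term a b c q m k = (1 - a * q ^ (2 * k)) / (1 - a) *
     (qpoch a q k * qpoch b q k * qpoch c q k * qpoch (1 / q ^ m) q k) /
     (qpoch q q k * qpoch (a * q / b) q k * qpoch (a * q / c) q k * qpoch (a * q ^ (m + 1)) q k) *
     (a * q ^ (m + 1) / (b * c)) ^ k"

text \<open>The algebraic core of the telescoping below, where \<open>y = q ^ Suc n\<close> and
  \<open>p = q ^ Suc m\<close> may be treated as independent variables.\<close>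

lemma vwp_rational_identity:
  fixes a b c p y :: "'a::field"
  assumes "b \<noteq> 0" "c \<noteq> 0" "p \<noteq> 0"
  shows "(1 - a * y) * (1 - b * y) * (1 - c * y) * (1 - y / p) * (a * p / (b * c))
      - (1 - y) * (1 - a * y / b) * (1 - a * y / c) * (1 - a * p * y)
    = (1 - a * y ^ 2) * ((1 - 1 / p) * y * (1 - a * p / b) * (1 - a * p / c)
      - (1 - a * p / (b * c)) * (1 - y / p) * (1 - a * p * y))"
proof -
  \<comment> \<open>Naming the inverses makes the claim a polynomial identity modulo
    \<open>b * B = 1\<close>, \<open>c * C = 1\<close>, \<open>p * P = 1\<close>.\<close>
  define B C P where "B = 1 / b" and "C = 1 / c" and "P = 1 / p"
  have *: "b * B = 1" "c * C = 1" "p * P = 1" using assms by (auto simp: B_def C_def P_def)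
  have "(1 - a * y) * (1 - b * y) * (1 - c * y) * (1 - y * P) * (a * p * (B * C))
      - (1 - y) * (1 - a * y * B) * (1 - a * y * C) * (1 - a * p * y)
    = (1 - a * y ^ 2) * ((1 - P) * y * (1 - a * p * B) * (1 - a * p * C)
      - (1 - a * p * (B * C)) * (1 - y * P) * (1 - a * p * y))"
    using * by algebra
  then show ?thesis by (simp add: B_def C_def P_def)
qed

text \<open>\<open>\<rho> m\<close> is the quotient of the expected closed forms for
  \<open>Suc m\<close> and \<open>m\<close>. In the manner of the WZ method, each summand on the
  left is a difference of consecutive values of the right-hand side, whose factor
  \<open>qpoch (1 / q ^ m) q n\<close> vanishes at \<open>n = Suc m\<close>.\<close>

lemma vwp_telescope:
  fixes a b c q :: "'a::field"
  assumes q0: "q \<noteq> 0" and b0: "b \<noteq> 0" and c0: "c \<noteq> 0"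
    and q1: "\<And>i. q ^ Suc i \<noteq> 1" and a1: "\<And>i. a * q ^ i \<noteq> 1"
    and ab1: "\<And>i. a * q ^ Suc i / b \<noteq> 1" and ac1: "\<And>i. a * q ^ Suc i / c \<noteq> 1"
  defines "w \<equiv> (\<lambda>m. a * q ^ Suc m)"
  defines "\<rho> \<equiv> (\<lambda>m. (1 - w m) * (1 - w m / (b * c)) / ((1 - w m / b) * (1 - w m / c)))"
  shows "(\<Sum>k\<le>n. vwp_term a b c q (Suc m) k - \<rho> m * vwp_term a b c q m k) =
    (1 - \<rho> m) * (qpoch (a * q) q n * qpoch (b * q) q n * qpoch (c * q) q n * qpoch (1 / q ^ m) q n) /
     (qpoch q q n * qpoch (a * q / b) q n * qpoch (a * q / c) q n * qpoch (a * q ^ (m + 2)) q n) *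
     (w m / (b * c)) ^ n"
    (is "_ = ?H n")
proof (induction n)
  case 0
  then show ?case using a1[of 0] by (simp add: vwp_term_def)
next
  case (Suc n)
  \<comment> \<open>Everything at \<open>Suc n\<close> is written as \<open>K\<close>, the
    right-hand side at \<open>n\<close> without \<open>1 - \<rho> m\<close>, times a rational
    function of \<open>a\<close>, \<open>b\<close>, \<open>c\<close>, \<open>y\<close>,
    \<open>p\<close>. \<open>D\<close> collects the denominator factors gained in the step.\<close>
  define y p where "y = q ^ Suc n" and "p = q ^ Suc m"
  define K where "K = (qpoch (a * q) q n * qpoch (b * q) q n * qpoch (c * q) q n * qpoch (1 / q ^ m) q n) /
     (qpoch q q n * qpoch (a * q / b) q n * qpoch (a * q / c) q n * qpoch (a * q ^ (m + 2)) q n) *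
     (w m / (b * c)) ^ n"
  define D where "D = (1 - y) * (1 - a * y / b) * (1 - a * y / c) * (1 - a * p * y)"
  have p0: "p \<noteq> 0" and wp: "w m = a * p" using q0 by (auto simp: p_def w_def)
  have y1: "1 - y \<noteq> 0" and ayb: "1 - a * y / b \<noteq> 0" and ayc: "1 - a * y / c \<noteq> 0"
    and apb: "1 - a * p / b \<noteq> 0" and apc: "1 - a * p / c \<noteq> 0"
    using q1[of n] ab1[of n] ac1[of n] ab1[of m] ac1[of m] by (auto simp: y_def p_def)
  have ap: "1 - a * p \<noteq> 0" using a1[of "Suc m"] by (auto simp: p_def)
  have apy: "1 - a * p * y \<noteq> 0" using a1[of "Suc m + Suc n"]
    by (auto simp: p_def y_def power_add mult_ac)
  have a0: "1 - a \<noteq> 0" using a1[of 0] by auto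
  have D0: "D \<noteq> 0" using y1 ayb ayc apy by (simp add: D_def)
  have e1: "1 / q ^ m * q ^ n = y / p" "q * q ^ n = y" "a * q / b * q ^ n = a * y / b" "a * q / c * q ^ n = a * y / c"
     "a * q * q ^ n = a * y" "b * q * q ^ n = b * y" "c * q * q ^ n = c * y"
     "a * q ^ (m + 2) * q ^ n = a * p * y" "1 / q ^ Suc m * q = 1 / q ^ m" "a * q ^ (m + 1) * q = a * q ^ (m + 2)"
     "1 / q ^ Suc m = 1 / p" "a * q ^ (m + 1) = a * p"
    using q0 by (auto simp: y_def p_def field_simps power_add power2_eq_square)
  have e2: "q ^ (2 * Suc n) = y ^ 2"
    unfolding y_def by (metis power_mult mult.commute)
  have H: "?H (Suc n) = (1 - \<rho> m) * K * ((1 - a * y) * (1 - b * y) * (1 - c * y) * (1 - y / p) / D * (a * p / (b * c)))"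
    unfolding qpoch_Suc e1 K_def D_def wp by (simp add: mult_ac)
  have qs: "qpoch a q (Suc n) = (1 - a) * qpoch (a * q) q n"
    "qpoch b q (Suc n) = (1 - b) * qpoch (b * q) q n"
    "qpoch c q (Suc n) = (1 - c) * qpoch (c * q) q n"
    "qpoch q q (Suc n) = qpoch q q n * (1 - y)"
    "qpoch (a * q / b) q (Suc n) = qpoch (a * q / b) q n * (1 - a * y / b)"
    "qpoch (a * q / c) q (Suc n) = qpoch (a * q / c) q n * (1 - a * y / c)"
    "qpoch (1 / q ^ m) q (Suc n) = qpoch (1 / q ^ m) q n * (1 - y / p)"
    "qpoch (1 / q ^ Suc m) q (Suc n) = (1 - 1 / p) * qpoch (1 / q ^ m) q n"
    "qpoch (a * q ^ (m + 1)) q (Suc n) = (1 - a * p) * qpoch (a * q ^ (m + 2)) q n"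
    "qpoch (a * q ^ (Suc m + 1)) q (Suc n) = qpoch (a * q ^ (m + 2)) q n * (1 - a * p * y)"
    subgoal by (rule qpoch_Suc_shift)
    subgoal by (rule qpoch_Suc_shift)
    subgoal by (rule qpoch_Suc_shift)
    subgoal by (simp only: qpoch_Suc e1)
    subgoal by (simp only: qpoch_Suc e1)
    subgoal by (simp only: qpoch_Suc e1)
    subgoal by (simp only: qpoch_Suc e1)
    subgoal by (simp only: qpoch_Suc_shift e1(9)) (simp only: e1)
    subgoal by (simp only: qpoch_Suc_shift e1(10)) (simp only: e1)
    subgoal using e1(8) by (simp add: qpoch_Suc mult_ac)
    done
  have T0: "vwp_term a b c q m (Suc n) =
     K * ((1 - a * y ^ 2) * ((1 - b) * (1 - c) * (1 - y / p)) * (1 - a * p * y)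
        / (D * (1 - a * p)) * (a * p / (b * c)))"
    unfolding vwp_term_def qs e2 K_def D_def wp
    using a0 apy by (simp add: mult_ac p_def)
  have "vwp_term a b c q (Suc m) (Suc n) =
     (1 - a * y ^ 2) / (1 - a) * ((1 - a) * qpoch (a * q) q n * ((1 - b) * qpoch (b * q) q n)
       * ((1 - c) * qpoch (c * q) q n) * ((1 - 1 / p) * qpoch (1 / q ^ m) q n)) /
     (qpoch q q n * (1 - y) * (qpoch (a * q / b) q n * (1 - a * y / b)) * (qpoch (a * q / c) q n * (1 - a * y / c)) *
     (qpoch (a * q ^ (m + 2)) q n * (1 - a * p * y))) * (a * p * q / (b * c)) ^ Suc n"
    unfolding vwp_term_def qs e2 by (simp add: p_def mult_ac)
  also have "(a * p * q / (b * c)) ^ Suc n = (a * p / (b * c)) ^ n * (a * p / (b * c)) * y"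
    by (simp add: y_def power_divide power_mult_distrib mult_ac)
  finally have T1: "vwp_term a b c q (Suc m) (Suc n) =
     K * ((1 - a * y ^ 2) * ((1 - b) * (1 - c) * (1 - 1 / p)) * y / D * (a * p / (b * c)))"
    unfolding K_def D_def wp using a0 by (simp add: mult_ac)
  define S where "S = (1 - a * p / b) * (1 - a * p / c)"
  define F where "F = (1 - b) * (1 - c) * (a * p / (b * c))"
  have S0: "S \<noteq> 0" using apb apc by (simp add: S_def)
  \<comment> \<open>The factors \<open>(1 - b) * (1 - c)\<close> of \<open>F\<close> are those by
    which \<open>qpoch b q (Suc n)\<close> and \<open>qpoch c q (Suc n)\<close> exceed the shifted
    products in \<open>K\<close>.\<close>
  have rho1: "1 - \<rho> m = F / S"
  proof -
    have "S - (1 - a * p) * (1 - a * p / (b * c)) = F"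
      using b0 c0 by (simp add: S_def F_def field_simps)
    moreover have "1 - \<rho> m = (S - (1 - a * p) * (1 - a * p / (b * c))) / S"
      unfolding \<rho>_def wp S_def[symmetric] diff_divide_distrib using S0 by simp
    ultimately show ?thesis by simp
  qed
  have rho: "\<rho> m = (1 - a * p) * (1 - a * p / (b * c)) / S"
    unfolding \<rho>_def wp S_def ..
  let ?N = "(1 - a * y) * (1 - b * y) * (1 - c * y) * (1 - y / p) * (a * p / (b * c))"
  have "?H (Suc n) - ?H n = (1 - \<rho> m) * K * (?N / D - 1)"
    unfolding H by (simp add: K_def algebra_simps)
  also have "?N / D - 1 = (?N - D) / D" using D0 by (simp add: diff_divide_distrib)
  also have "?N - D = (1 - a * y ^ 2) * ((1 - 1 / p) * y * S
      - (1 - a * p / (b * c)) * (1 - y / p) * (1 - a * p * y))"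
    unfolding D_def S_def using vwp_rational_identity[OF b0 c0 p0, of a y] by (simp add: mult.assoc)
  also have "(1 - \<rho> m) * K * (\<dots> / D) = vwp_term a b c q (Suc m) (Suc n) - \<rho> m * vwp_term a b c q m (Suc n)"
    unfolding T0 T1 rho1 unfolding rho F_def
  proof -
    \<comment> \<open>With the compound factors as atoms, only the cancellation of \<open>S\<close>,
      \<open>D\<close> and \<open>r\<close> remains.\<close>
    have "B * C * X / S * K * (u1 * (u2 * y * S - u5 * u3 * u4) / D) =
        K * (u1 * (B * C * u2) * y / D * X) - r * u5 / S * (K * (u1 * (B * C * u3) * u4 / (D * r) * X))"
      if "r \<noteq> 0" for B C X u1 u2 u3 u4 u5 r :: 'a
      using S0 D0 that by (simp add: field_simps)
    from this[OF ap] show "(1 - b) * (1 - c) * (a * p / (b * c)) / S * K *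
        ((1 - a * y ^ 2) * ((1 - 1 / p) * y * S - (1 - a * p / (b * c)) * (1 - y / p) * (1 - a * p * y)) / D) =
        K * ((1 - a * y ^ 2) * ((1 - b) * (1 - c) * (1 - 1 / p)) * y / D * (a * p / (b * c))) -
        (1 - a * p) * (1 - a * p / (b * c)) / S * (K * ((1 - a * y ^ 2) * ((1 - b) * (1 - c) * (1 - y / p)) *
        (1 - a * p * y) / (D * (1 - a * p)) * (a * p / (b * c))))" .
  qed
  finally show ?case unfolding sum.atMost_Suc Suc.IH by (simp only: diff_eq_eq add.commute)
qed

text \<open>Summing the telescoped relation up to \<open>Suc m\<close> gives a first-order
  recurrence in the terminating parameter \<open>m\<close>, which the closed form also
  satisfies.\<close>

theorem terminating_6phi5:
  fixes a b c q :: "'a::field"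
  assumes q0: "q \<noteq> 0" and b0: "b \<noteq> 0" and c0: "c \<noteq> 0"
    and q1: "\<And>i. q ^ Suc i \<noteq> 1" and a1: "\<And>i. a * q ^ i \<noteq> 1"
    and ab1: "\<And>i. a * q ^ Suc i / b \<noteq> 1" and ac1: "\<And>i. a * q ^ Suc i / c \<noteq> 1"
  shows "(\<Sum>k\<le>m. vwp_term a b c q m k) =
    qpoch (a * q) q m * qpoch (a * q / (b * c)) q m / (qpoch (a * q / b) q m * qpoch (a * q / c) q m)"
proof (induction m)
  case 0
  then show ?case using a1[of 0] by (simp add: vwp_term_def)
next
  case (Suc m)
  define w where "w = a * q ^ Suc m"
  define \<rho> where "\<rho> = (1 - w) * (1 - w / (b * c)) / ((1 - w / b) * (1 - w / c))"
  \<comment> \<open>The last factor is \<open>1 - 1 / q ^ m * q ^ m\<close>. It kills both the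
    telescoped value and the additional term \<open>k = Suc m\<close> of the series for
    \<open>m\<close>.\<close>
  have zero: "qpoch (1 / q ^ m) q (Suc m) = 0"
    using q0 by (simp add: qpoch_Suc)
  have "(\<Sum>k\<le>Suc m. vwp_term a b c q (Suc m) k - \<rho> * vwp_term a b c q m k) = 0"
    unfolding \<rho>_def w_def vwp_telescope[OF assms] zero by simp
  moreover have "vwp_term a b c q m (Suc m) = 0"
    unfolding vwp_term_def zero by simp
  ultimately have "(\<Sum>k\<le>Suc m. vwp_term a b c q (Suc m) k) = \<rho> * (\<Sum>k\<le>m. vwp_term a b c q m k)"
    by (simp add: sum_subtractf sum_distrib_left)
  then show ?case unfolding Suc.IH qpoch_Suc \<rho>_def w_def by (simp add: mult_ac)
qed

section \<open>Factors \<open>1 - q^x\<close> in the local ring\<close>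

lemma qvar_nonzero [simp]: "qvar \<noteq> 0"
  by (simp add: qvar_def)

lemma qvar_power: "qvar ^ j = to_fract (monom 1 j)"
  by (simp add: qvar_def monom_altdef to_fract_power)

text \<open>Exponents are integers because shifted parameters such as \<open>2 - 2 * int M\<close>
  can be negative.\<close>

definition qfactor :: "int \<Rightarrow> ratfun" where
  "qfactor x = 1 - qvar powi x"

lemma qfactor_0 [simp]: "qfactor 0 = 0"
  by (simp add: qfactor_def)

lemma qfactor_of_nat: "qfactor (int j) = - to_fract (monom 1 j - 1)"
  by (simp add: qfactor_def qvar_power)

lemma qfactor_minus: "qfactor (- x) = - (qvar powi (- x)) * qfactor x"
  by (simp add: qfactor_def power_int_minus algebra_simps)

lemma qfactor_add: "qfactor (x + y) = qfactor x + qvar powi x * qfactor y"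
  by (simp add: qfactor_def power_int_add algebra_simps)

lemma qfactor_nonzero: "x \<noteq> 0 \<Longrightarrow> qfactor x \<noteq> 0"
proof -
  have pos: "qfactor (int j) \<noteq> 0" if "j > 0" for j
  proof
    assume "qfactor (int j) = 0"
    then have "monom 1 j - 1 = (0 :: rat poly)"
      unfolding qfactor_of_nat by (simp only: neg_equal_0_iff_equal to_fract_eq_0_iff)
    then have "coeff (monom 1 j) 0 = coeff (1 :: rat poly) 0" by simp
    then show False using that by simp
  qed
  assume "x \<noteq> 0"
  then show ?thesis
    using pos[of "nat x"] pos[of "nat (- x)"] qfactor_minus[of "- x"] by (cases "x > 0") auto
qed

lemma one_plus_qvar_powi: "x \<noteq> 0 \<Longrightarrow> 1 + qvar powi x = qfactor (2 * x) / qfactor x"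
proof -
  assume "x \<noteq> 0"
  moreover have "qfactor (2 * x) = (1 + qvar powi x) * qfactor x"
    using power_int_add[of qvar x x] by (simp add: qfactor_def algebra_simps)
  ultimately show ?thesis using qfactor_nonzero[of x] by simp
qed

lemma qfactor_mult_nat: "qfactor (int (M * c)) = qfactor (int M) * to_fract (\<Sum>i<c. monom 1 (M * i))"
  unfolding qfactor_of_nat
proof (induction c)
  case 0
  then show ?case by simp
next
  case (Suc c)
  have "monom 1 (M * Suc c) - 1 = (monom 1 (M * c) - 1 + (monom 1 M - 1) * monom 1 (M * c) :: rat poly)"
    by (simp add: algebra_simps mult_monom)
  then show ?case using Suc by (simp add: algebra_simps)
qed

locale cyclotomic_loc =
  fixes M :: nat
  assumes M_pos: "M > 0"
begin

abbreviation "P \<equiv> cyclotomic M"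

lemma powi_loc: "qvar powi x \<in> loc P"
proof -
  have "qvar \<in> loc P" by (simp add: qvar_def loc_to_fract)
  moreover have "inverse qvar \<in> loc P"
    using locI[of "[:0, 1:]" P 1] coprime_cyclotomic_X[OF M_pos] by (simp add: qvar_def inverse_eq_divide)
  ultimately show ?thesis by (auto simp: power_int_def intro!: loc_power)
qed

lemma power_loc: "qvar ^ j \<in> loc P"
  using powi_loc[of "int j"] by simp

lemma qfactor_loc: "qfactor x \<in> loc P"
  unfolding qfactor_def by (intro loc_diff loc_1 powi_loc)

lemma qfactor_ideal:
  assumes "int M dvd x"
  shows "qfactor x \<in> ideal P 1"
proof -
  have pos: "qfactor (int j) \<in> ideal P 1" if "M dvd j" for j
  proof (cases "j = 0")
    case True
    then show ?thesis by (simp add: ideal_0)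
  next
    case False
    then obtain W where "monom 1 j - 1 = P * W" using cyclotomic_dvd[of j M] \<open>M dvd j\<close> by auto
    then have "qfactor (int j) = to_fract P ^ 1 * - to_fract W" by (simp add: qfactor_of_nat del: to_fract_diff)
    then show ?thesis by (rule idealI[rotated]) (intro loc_uminus loc_to_fract)
  qed
  show ?thesis
  proof (cases x rule: int_cases2)
    case (nonneg j)
    then show ?thesis using pos[of j] assms by simp
  next
    case (nonpos j)
    then have "qfactor (- x) \<in> ideal P 1" using pos[of j] assms by simp
    then show ?thesis using qfactor_minus[of "- x"] by (auto intro!: ideal_uminus loc_mult_ideal powi_loc)
  qed
qed

lemma inverse_qfactor_loc:
  assumes "\<not> int M dvd x"
  shows "inverse (qfactor x) \<in> loc P"
proof -
  have pos: "inverse (qfactor (int j)) \<in> loc P" if "\<not> M dvd j" for j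
  proof -
    have "qfactor (int j) \<noteq> 0" using that by (intro qfactor_nonzero) (auto intro: Nat.gr0I)
    then have "monom 1 j - 1 \<noteq> (0 :: rat poly)" unfolding qfactor_of_nat by auto
    then have "to_fract (- 1) / to_fract (monom 1 j - 1) \<in> loc P"
      using coprime_cyclotomic_X_pow_minus_1[OF M_pos that] by (intro locI)
    then show ?thesis by (simp add: qfactor_of_nat inverse_eq_divide minus_divide_right)
  qed
  show ?thesis
  proof (cases x rule: int_cases2)
    case (nonneg j)
    then show ?thesis using pos[of j] assms by simp
  next
    case (nonpos j)
    then have "inverse (qfactor (- x)) \<in> loc P" using pos[of j] assms by simp
    then have "- (qvar powi (- x)) * inverse (qfactor (- x)) \<in> loc P" by (intro loc_mult loc_uminus powi_loc)
    also have "- (qvar powi (- x)) * inverse (qfactor (- x)) = inverse (qfactor x)"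
      using qfactor_minus[of "- x"] by (simp add: power_int_minus)
    finally show ?thesis .
  qed
qed

text \<open>If \<open>M\<close> divides both exponents, the common factor
  \<open>qfactor (int M)\<close> cancels and leaves a geometric sum coprime to \<open>P\<close> in
  the denominator. Otherwise the denominator is already invertible.\<close>

lemma qfactor_quotient_loc:
  assumes "y > 0" "x \<ge> 0" "int M dvd y \<Longrightarrow> int M dvd x"
  shows "qfactor x / qfactor y \<in> loc P"
proof (cases "int M dvd y")
  case False
  then show ?thesis unfolding divide_inverse by (intro loc_mult qfactor_loc inverse_qfactor_loc)
next
  case True
  obtain c where c: "x = int (M * c)" using assms(2) assms(3)[OF True]
    by (metis dvdE int_dvd_int_iff nonneg_int_cases)
  obtain d where d: "y = int (M * d)" using assms(1) True
    by (metis dvdE int_dvd_int_iff pos_int_cases)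
  have d0: "d > 0" using assms(1) d by (auto intro: Nat.gr0I)
  define C D :: "rat poly" where "C = (\<Sum>i<c. monom 1 (M * i))" and "D = (\<Sum>i<d. monom 1 (M * i))"
  have y: "qfactor y = qfactor (int M) * to_fract D" and x: "qfactor x = qfactor (int M) * to_fract C"
    unfolding c d C_def D_def by (rule qfactor_mult_nat)+
  have "qfactor y \<noteq> 0" using assms(1) by (intro qfactor_nonzero) simp
  then have "D \<noteq> 0" "qfactor (int M) \<noteq> 0" unfolding y by auto
  moreover have "coprime D P" unfolding D_def using coprime_cyclotomic_geometric_sum[OF M_pos d0] .
  ultimately show ?thesis unfolding x y by (simp add: locI)
qed

section \<open>Congruence modulo the square of the cyclotomic polynomial\<close>

definition cong2 :: "ratfun \<Rightarrow> ratfun \<Rightarrow> bool" where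
  "cong2 f g \<longleftrightarrow> f \<in> loc P \<and> g \<in> loc P \<and> f - g \<in> ideal P 2"

lemma cong2_refl: "f \<in> loc P \<Longrightarrow> cong2 f f"
  by (simp add: cong2_def ideal_0)

text \<open>The integrality recorded in \<open>cong2\<close> allows one factor to be exchanged at a
  time.\<close>

lemma cong2_mult: assumes "cong2 f g" "cong2 f' g'" shows "cong2 (f * f') (g * g')"
proof -
  have "f * f' - g * g' = (f - g) * f' + g * (f' - g')" by (simp add: algebra_simps)
  moreover have "(f - g) * f' + g * (f' - g') \<in> ideal P 2"
    using assms unfolding cong2_def
    by (intro ideal_add ideal_mult_loc[of "f - g"] loc_mult_ideal[of g]) auto
  ultimately show ?thesis using assms unfolding cong2_def by (auto intro: loc_mult)
qed

lemma cong2_prod: "(\<And>i. i \<in> A \<Longrightarrow> cong2 (f i) (g i)) \<Longrightarrow> cong2 (prod f A) (prod g A)"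
  by (induction A rule: infinite_finite_induct) (auto intro: cong2_mult cong2_refl loc_1)

lemma cong2_inverse:
  assumes "cong2 f g" "inverse f \<in> loc P" "inverse g \<in> loc P" "f \<noteq> 0" "g \<noteq> 0"
  shows "cong2 (inverse f) (inverse g)"
proof -
  have "inverse f - inverse g = - (inverse f * ((f - g) * inverse g))"
    using assms(4,5) by (simp add: field_simps)
  moreover have "\<dots> \<in> ideal P 2"
    using assms unfolding cong2_def
    by (intro ideal_uminus loc_mult_ideal[of "inverse f"] ideal_mult_loc[of "f - g"]) auto
  ultimately show ?thesis using assms unfolding cong2_def by simp
qed

text \<open>With \<open>A = 1 - qfactor a\<close>, \<open>B = 1 - qfactor b\<close> and the third
  power equal to \<open>inverse (A * B)\<close>, the constant and linear terms in
  \<open>qfactor a\<close> and \<open>qfactor b\<close> cancel; both lie in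
  \<open>ideal P 1\<close>.\<close>

lemma sum_powi_ideal:
  assumes "int M dvd a" "int M dvd b" "a + b + c = 0"
  shows "qvar powi a + qvar powi b + qvar powi c - 3 \<in> ideal P 2"
proof -
  have c: "c = - (a + b)" using assms by simp
  define A B where "A = qvar powi a" and "B = qvar powi b"
  have nz: "A \<noteq> 0" "B \<noteq> 0" by (auto simp: A_def B_def)
  have C: "qvar powi c = inverse (A * B)"
    unfolding c power_int_minus by (simp add: power_int_add A_def B_def)
  have "A + B + inverse (A * B) - 3 = inverse (A * B) * (A * B * (A + B - 3) + 1)"
    using nz by (simp add: field_simps)
  also have "A * B * (A + B - 3) + 1 = (qfactor a + qfactor b) * (qfactor a + qfactor b) - qfactor a * qfactor b * (qfactor a + qfactor b + 1)"
    by (simp add: qfactor_def A_def[symmetric] B_def[symmetric] algebra_simps)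
  also have "inverse (A * B) = qvar powi c" by (rule C[symmetric])
  finally have "A + B + qvar powi c - 3 =
    qvar powi c * ((qfactor a + qfactor b) * (qfactor a + qfactor b) - qfactor a * qfactor b * (qfactor a + qfactor b + 1))"
    by (simp only: C)
  moreover have "(qfactor a + qfactor b) * (qfactor a + qfactor b) \<in> ideal P (1 + 1)" "qfactor a * qfactor b \<in> ideal P (1 + 1)"
    using assms by (intro ideal_mult ideal_add qfactor_ideal; simp)+
  ultimately show ?thesis
    by (auto simp: A_def B_def numeral_2_eq_2 simp del: distrib_right_numeral intro!: loc_mult_ideal ideal_diff ideal_mult_loc[of "qfactor a * qfactor b"] powi_loc loc_add qfactor_loc loc_1)
qed

text \<open>In the expansion in \<open>W\<close>, the coefficients involve the elementary symmetric
  functions of \<open>A\<close>, \<open>B\<close>, \<open>C\<close>. Since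
  \<open>A * B * C = 1\<close>, the second one is the sum of the inverses, so
  \<open>sum_powi_ideal\<close> applies to the shifts and to their negatives.\<close>

lemma qfactor_cube_cong2:
  assumes "int M dvd a" "int M dvd b" "a + b + c = 0"
  shows "cong2 (qfactor x ^ 3) (qfactor (x + a) * qfactor (x + b) * qfactor (x + c))"
proof -
  define A B C W where "A = qvar powi a" and "B = qvar powi b" and "C = qvar powi c" and "W = qvar powi x"
  have "A * B * C = qvar powi (a + b + c)" unfolding A_def B_def C_def by (simp add: power_int_add)
  then have ABC: "A * B * C = 1" using assms(3) by simp
  have nz: "A \<noteq> 0" "B \<noteq> 0" "C \<noteq> 0" by (auto simp: A_def B_def C_def)
  have inv: "A * B = inverse C" "A * C = inverse B" "B * C = inverse A"
    using ABC nz by (simp_all add: field_simps)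
  have "qfactor x ^ 3 - qfactor (x + a) * qfactor (x + b) * qfactor (x + c) = (1 - W) ^ 3 - (1 - W * A) * (1 - W * B) * (1 - W * C)"
    by (simp add: qfactor_def A_def B_def C_def W_def power_int_add)
  also have "\<dots> = W * (A + B + C - 3) - W ^ 2 * (A * B + A * C + B * C - 3) + W ^ 3 * (A * B * C - 1)"
    by (simp add: algebra_simps power2_eq_square power3_eq_cube)
  also have "\<dots> = W * (A + B + C - 3) - W ^ 2 * (inverse A + inverse B + inverse C - 3)"
    unfolding ABC unfolding inv by (simp add: algebra_simps)
  also have "\<dots> \<in> ideal P 2"
    using sum_powi_ideal[OF assms] sum_powi_ideal[of "- a" "- b" "- c"] assms
    unfolding A_def B_def C_def W_def
    by (intro ideal_diff[OF loc_mult_ideal[OF powi_loc] loc_mult_ideal[OF loc_power[OF powi_loc]]])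
      (auto simp: power_int_minus)
  finally show ?thesis unfolding cong2_def by (auto intro!: loc_mult loc_power qfactor_loc)
qed

end

section \<open>The products (q^a; q^4)_k and the closed form of a block\<close>

definition qfactors :: "int \<Rightarrow> nat \<Rightarrow> ratfun" where
  "qfactors a k = (\<Prod>i<k. qfactor (a + 4 * int i))"

lemma qfactors_0 [simp]: "qfactors a 0 = 1"
  by (simp add: qfactors_def)

lemma qfactors_add: "qfactors a (j + k) = qfactors a j * qfactors (a + 4 * int j) k"
  by (induction k) (simp_all add: qfactors_def algebra_simps)

lemma qfactors_Suc: "qfactors a (Suc k) = qfactors a k * qfactor (a + 4 * int k)"
  by (simp add: qfactors_def)

lemma qfactors_Suc_shift: "qfactors a (Suc k) = qfactor a * qfactors (a + 4) k"
  using qfactors_add[of a 1 k] by (simp add: qfactors_def)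

lemma qfactors_nonzero: "(\<And>i. i < k \<Longrightarrow> a + 4 * int i \<noteq> 0) \<Longrightarrow> qfactors a k \<noteq> 0"
  by (auto simp: qfactors_def qfactor_nonzero)

lemma qpoch_powi: "qpoch (qvar powi a) (qvar ^ 4) k = qfactors a k"
proof -
  have "qvar powi (4 * int i) = (qvar ^ 4) ^ i" for i
    by (simp add: power_int_mult)
  then show ?thesis by (simp add: qpoch_def qfactors_def qfactor_def power_int_add)
qed

lemma qvar_powi_mult: "qvar powi a * qvar powi b = qvar powi (a + b)"
  by (simp add: power_int_add)

lemma qvar_powi_divide: "qvar powi a / qvar powi b = qvar powi (a - b)"
  by (simp add: power_int_diff)

lemma qvar_powi_eq_1: "qvar powi x = 1 \<longleftrightarrow> x = 0"
  using qfactor_nonzero[of x] by (auto simp: qfactor_def)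

lemma qvar_power4: "(qvar ^ 4) ^ k = qvar powi (4 * int k)"
  by (simp add: power_int_mult)

text \<open>The base is q^4, and \<open>M = 2 * m + 1\<close> makes the argument of the series equal
  to q. As \<open>b\<close> is a square root of \<open>a\<close>,
  \<open>qfactors (1 + L) k / qfactors (5 + L) k\<close> collapses to a quotient of two factors,
  which turns the very-well-poised factor into one of the form 1 + q^x.\<close>

lemma vwp_term_qvar:
  assumes "M = 2 * m + 1" "L \<ge> 0"
  shows "vwp_term (qvar powi (2 + 2 * L)) (qvar powi (1 + L)) (qvar powi (2 + 2 * int M + L)) (qvar ^ 4) m k
    = (1 + qvar powi (L + 1 + 4 * int k)) / (1 + qvar powi (L + 1)) *
      (qfactors (2 + 2 * L) k * qfactors (2 - 2 * int M) k * qfactors (2 + 2 * int M + L) k) /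
      (qfactors 4 k * qfactors (4 + 2 * int M + 2 * L) k * qfactors (4 - 2 * int M + L) k) * qvar ^ k"
proof -
  let ?a = "qvar powi (2 + 2 * L)" and ?b = "qvar powi (1 + L)" and ?c = "qvar powi (2 + 2 * int M + L)"
  have q4: "qvar ^ 4 = qvar powi 4" by simp
  have p: "?a * qvar ^ 4 / ?b = qvar powi (5 + L)" "?a * qvar ^ 4 / ?c = qvar powi (4 - 2 * int M + L)"
    "?a * (qvar ^ 4) ^ (m + 1) = qvar powi (4 + 2 * int M + 2 * L)"
    "1 / (qvar ^ 4) ^ m = qvar powi (2 - 2 * int M)"
    "?a * (qvar ^ 4) ^ (2 * k) = qvar powi (2 * (L + 1 + 4 * int k))"
    unfolding qvar_power4 unfolding q4 qvar_powi_mult qvar_powi_divide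
    using assms(1) by (simp_all add: algebra_simps flip: power_int_minus_divide)
  have x: "?a * (qvar ^ 4) ^ (m + 1) / (?b * ?c) = qvar"
    unfolding p qvar_powi_mult qvar_powi_divide by (simp add: algebra_simps)
  have "qfactor (L + 1) * qfactors (5 + L) k = qfactors (1 + L) k * qfactor (L + 1 + 4 * int k)"
    using qfactors_Suc_shift[of "1 + L" k] qfactors_Suc[of "1 + L" k] by (simp add: add_ac)
  moreover have nz: "qfactor (L + 1) \<noteq> 0" "qfactor (L + 1 + 4 * int k) \<noteq> 0" "qfactors (5 + L) k \<noteq> 0"
    using assms(2) by (auto intro!: qfactor_nonzero qfactors_nonzero)
  ultimately have b: "qfactors (1 + L) k / qfactors (5 + L) k = qfactor (L + 1) / qfactor (L + 1 + 4 * int k)"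
    by (simp add: field_simps)
  have "vwp_term ?a ?b ?c (qvar ^ 4) m k = qfactor (2 * (L + 1 + 4 * int k)) / qfactor (2 + 2 * L) *
     (qfactors (2 + 2 * L) k * qfactors (1 + L) k * qfactors (2 + 2 * int M + L) k * qfactors (2 - 2 * int M) k) /
     (qfactors 4 k * qfactors (5 + L) k * qfactors (4 - 2 * int M + L) k * qfactors (4 + 2 * int M + 2 * L) k) * qvar ^ k"
    unfolding vwp_term_def x unfolding p qpoch_powi
    using qpoch_powi[of 4 k] by (simp add: qfactor_def)
  also have "\<dots> = qfactor (2 * (L + 1 + 4 * int k)) / qfactor (2 * (L + 1)) * (qfactors (1 + L) k / qfactors (5 + L) k) *
     (qfactors (2 + 2 * L) k * qfactors (2 - 2 * int M) k * qfactors (2 + 2 * int M + L) k) /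
      (qfactors 4 k * qfactors (4 + 2 * int M + 2 * L) k * qfactors (4 - 2 * int M + L) k) * qvar ^ k"
    by (simp add: mult_ac add_ac)
  also have "qfactor (2 * (L + 1 + 4 * int k)) / qfactor (2 * (L + 1)) * (qfactors (1 + L) k / qfactors (5 + L) k) =
     (1 + qvar powi (L + 1 + 4 * int k)) / (1 + qvar powi (L + 1))"
    unfolding b using assms(2) nz by (subst (1 2) one_plus_qvar_powi) (auto simp: field_simps)
  finally show ?thesis .
qed

lemma terminating_block_sum:
  assumes "M = 2 * m + 1" "L \<ge> 0" "4 dvd L"
  shows "(\<Sum>k\<le>m. (1 + qvar powi (L + 1 + 4 * int k)) *
      (qfactors (2 + 2 * L) k * qfactors (2 - 2 * int M) k * qfactors (2 + 2 * int M + L) k) /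
      (qfactors 4 k * qfactors (4 + 2 * int M + 2 * L) k * qfactors (4 - 2 * int M + L) k) * qvar ^ k) =
    (1 + qvar powi (L + 1)) *
      (qfactors (6 + 2 * L) m * qfactors (3 - 2 * int M) m / (qfactors (5 + L) m * qfactors (4 - 2 * int M + L) m))"
    (is "(\<Sum>k\<le>m. ?f k) = _")
proof -
  let ?a = "qvar powi (2 + 2 * L)" and ?b = "qvar powi (1 + L)" and ?c = "qvar powi (2 + 2 * int M + L)"
  have q4: "qvar ^ 4 = qvar powi 4" by simp
  have p: "?a * qvar ^ 4 / ?b = qvar powi (5 + L)" "?a * qvar ^ 4 / ?c = qvar powi (4 - 2 * int M + L)"
    "?a * qvar ^ 4 / (?b * ?c) = qvar powi (3 - 2 * int M)"
    "?a * qvar ^ 4 = qvar powi (6 + 2 * L)"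
    unfolding q4 qvar_powi_mult qvar_powi_divide
    by (simp_all add: algebra_simps)
  have nz: "1 + qvar powi (L + 1) \<noteq> 0"
    using assms(2) by (subst one_plus_qvar_powi) (auto simp: qfactor_nonzero)
  have "(\<Sum>k\<le>m. ?f k) = (\<Sum>k\<le>m. (1 + qvar powi (L + 1)) * vwp_term ?a ?b ?c (qvar ^ 4) m k)"
    unfolding vwp_term_qvar[OF assms(1,2)] using nz by (intro sum.cong) auto
  also have "\<dots> = (1 + qvar powi (L + 1)) * (\<Sum>k\<le>m. vwp_term ?a ?b ?c (qvar ^ 4) m k)"
    by (simp add: sum_distrib_left)
  also have "(\<Sum>k\<le>m. vwp_term ?a ?b ?c (qvar ^ 4) m k) =
      qpoch (?a * qvar ^ 4) (qvar ^ 4) m * qpoch (?a * qvar ^ 4 / (?b * ?c)) (qvar ^ 4) m /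
      (qpoch (?a * qvar ^ 4 / ?b) (qvar ^ 4) m * qpoch (?a * qvar ^ 4 / ?c) (qvar ^ 4) m)"
  proof (rule terminating_6phi5)
    fix i :: nat
    show "?a * (qvar ^ 4) ^ i \<noteq> 1" "?a * (qvar ^ 4) ^ Suc i / ?b \<noteq> 1" "(qvar ^ 4) ^ Suc i \<noteq> 1"
      unfolding qvar_power4 qvar_powi_mult qvar_powi_divide qvar_powi_eq_1 using assms(2) by auto
    \<comment> \<open>The exponent is congruent to \<open>- 2 * M\<close>, hence to 2, modulo 4, so
      it is not 0.\<close>
    show "?a * (qvar ^ 4) ^ Suc i / ?c \<noteq> 1"
      unfolding qvar_power4 qvar_powi_mult qvar_powi_divide qvar_powi_eq_1
      using assms(1,3) by (auto elim!: dvdE) presburger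
  qed simp_all
  finally show ?thesis unfolding p(1-3) unfolding p(4) qpoch_powi .
qed

lemma qint_qvar_square: "qint (qvar ^ 2) N = qfactor (2 * int N) / qfactor 2"
proof -
  have "qint (qvar ^ 2) N * qfactor 2 = qfactor (2 * int N)"
  proof (induction N)
    case (Suc N)
    have "(qvar ^ 2) ^ N = qvar powi (2 * int N)" by (simp add: power_int_mult)
    moreover have "qfactor (2 * int (Suc N)) = qfactor (2 * int N) + qvar powi (2 * int N) * qfactor 2"
      using qfactor_add[of "2 * int N" 2] by (simp add: algebra_simps)
    ultimately show ?case using Suc by (simp add: qint_def algebra_simps)
  qed (simp add: qint_def)
  then show ?thesis using qfactor_nonzero[of 2] by (simp add: field_simps)
qed

text \<open>Reversing the order of the factors turns the exponents \<open>3 - 2N, \<dots>, -3\<close> into \<open>-3, \<dots>, 3 - 2N\<close>.\<close>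
lemma closed_form_reflect:
  assumes "N = 2 * m + 1"
  shows "qfactors 6 m * qfactors (3 - 2 * int N) m / (qfactors 5 m * qfactors (4 - 2 * int N) m) =
    qint (qvar ^ 2) N * qfactors 3 m / qfactors 5 m * qvar powi (- int m)"
proof -
  have rev: "qfactors (b - 2 * int N) m = (\<Prod>i<m. qfactor (b - 6 - 4 * int i))" for b
    unfolding qfactors_def
    by (subst prod.nat_diff_reindex[symmetric], rule prod.cong)
      (use assms in \<open>auto simp: of_nat_diff algebra_simps\<close>)
  have "qfactors (3 - 2 * int N) m * qfactors 2 m = (\<Prod>i<m. qfactor (- 3 - 4 * int i) * qfactor (2 + 4 * int i))"
    unfolding rev by (simp add: qfactors_def prod.distrib)
  \<comment> \<open>The two reflections produce monomials with exponents \<open>- 3 - 4 * i\<close>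
    and \<open>- 2 - 4 * i\<close>. Their quotient q^(-1) occurs \<open>m\<close> times, which is
    the source of \<open>qvar powi (- int m)\<close>.\<close>
  also have "\<dots> = (\<Prod>i<m. inverse qvar * (qfactor (3 + 4 * int i) * qfactor (- 2 - 4 * int i)))"
  proof (rule prod.cong[OF refl])
    fix i
    have "qfactor (- 3 - 4 * int i) = - (qvar powi (- 1 + (- 2 - 4 * int i))) * qfactor (3 + 4 * int i)"
      using qfactor_minus[of "3 + 4 * int i"] by simp
    moreover have "qfactor (- 2 - 4 * int i) = - (qvar powi (- 2 - 4 * int i)) * qfactor (2 + 4 * int i)"
      using qfactor_minus[of "2 + 4 * int i"] by simp
    moreover have "qvar powi (- 1 + (- 2 - 4 * int i)) = inverse qvar * qvar powi (- 2 - 4 * int i)"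
      by (subst power_int_add) auto
    ultimately show "qfactor (- 3 - 4 * int i) * qfactor (2 + 4 * int i) =
        inverse qvar * (qfactor (3 + 4 * int i) * qfactor (- 2 - 4 * int i))"
      by simp
  qed
  also have "\<dots> = inverse qvar ^ m * (qfactors 3 m * qfactors (4 - 2 * int N) m)"
    unfolding rev by (simp add: qfactors_def prod.distrib)
  finally have 1: "qfactors (3 - 2 * int N) m * qfactors 2 m = qvar powi (- int m) * (qfactors 3 m * qfactors (4 - 2 * int N) m)"
    by (simp add: power_int_minus power_inverse)
  \<comment> \<open>Since \<open>2 + 4 * m = 2 * N\<close>, this quotient of shifted products is the
    q-integer of the right-hand side.\<close>
  have 2: "qfactors 6 m * qfactor 2 = qfactors 2 m * qfactor (2 * int N)"
    using qfactors_Suc_shift[of 2 m] qfactors_Suc[of 2 m] assms by (simp add: algebra_simps)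
  have nz: "qfactors 2 m \<noteq> 0" "qfactors 5 m \<noteq> 0" "qfactor 2 \<noteq> 0" "qfactors (4 - 2 * int N) m \<noteq> 0"
    using assms by (auto intro!: qfactors_nonzero qfactor_nonzero; presburger)+
  show ?thesis unfolding qint_qvar_square using nz 1 2
    by (simp add: divide_simps) algebra
qed

section \<open>Block sums\<close>

context cyclotomic_loc
begin

lemma qfactors_loc: "qfactors a k \<in> loc P"
  unfolding qfactors_def by (intro loc_prod qfactor_loc)

lemma inverse_qfactors_loc: "(\<And>i. i < k \<Longrightarrow> \<not> int M dvd a + 4 * int i) \<Longrightarrow> inverse (qfactors a k) \<in> loc P"
  unfolding qfactors_def prod_inversef[symmetric] comp_def by (intro loc_prod inverse_qfactor_loc) auto

lemma qfactors_ideal: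
  assumes "i < k" "int M dvd a + 4 * int i"
  shows "qfactors a k \<in> ideal P 1"
proof -
  have "qfactors a k = qfactor (a + 4 * int i) * (\<Prod>j\<in>{..<k} - {i}. qfactor (a + 4 * int j))"
    unfolding qfactors_def using assms(1) by (intro prod.remove) auto
  then show ?thesis
    using ideal_mult_loc[OF qfactor_ideal[OF assms(2)] loc_prod[OF qfactor_loc]] by metis
qed

lemma qfactors_cube_cong2:
  assumes "int M dvd a" "int M dvd b" "a + b + c = 0"
  shows "cong2 (qfactors x k ^ 3) (qfactors (x + a) k * qfactors (x + b) k * qfactors (x + c) k)"
proof -
  have "cong2 (\<Prod>i<k. qfactor (x + 4 * int i) ^ 3)
     (\<Prod>i<k. qfactor (x + 4 * int i + a) * qfactor (x + 4 * int i + b) * qfactor (x + 4 * int i + c))"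
    by (intro cong2_prod qfactor_cube_cong2 assms)
  then show ?thesis by (simp add: qfactors_def prod.distrib prod_power_distrib add_ac)
qed

text \<open>Matching the numerator exponent \<open>x\<close> with the denominator exponent \<open>x + 2M\<close> cancels the
  factor \<open>cyclotomic M\<close>, and leaves \<open>m = (M - 1) / 2\<close> factors at either end.\<close>
lemma qfactors_quotient_ideal:
  assumes "M = 2 * m + 1" "a \<ge> 0" "\<And>i. i < m \<Longrightarrow> \<not> int M dvd a + 2 + 4 * int i"
    and "qfactors (a + 4 * int k) m \<in> ideal P e"
  shows "qfactors a (k + m) / qfactors (a + 2) (k + m) \<in> ideal P e"
proof -
  have "qfactors (a + 2) (m + k) = qfactors (a + 2) m * qfactors (a + 2 * int M) k"
    unfolding qfactors_add using assms(1) by (simp add: algebra_simps)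
  then have "qfactors (a + 2) (k + m) = qfactors (a + 2) m * qfactors (a + 2 * int M) k" by (simp only: add.commute)
  then have "qfactors a (k + m) / qfactors (a + 2) (k + m) =
      (\<Prod>i<k. qfactor (a + 4 * int i) / qfactor (a + 2 * int M + 4 * int i)) * inverse (qfactors (a + 2) m)
        * qfactors (a + 4 * int k) m"
    unfolding qfactors_add[of a k m] prod_dividef qfactors_def[of a k, symmetric]
      qfactors_def[of "a + 2 * int M" k, symmetric] by (simp add: divide_inverse mult_ac)
  moreover have "qfactor (a + 4 * int i) / qfactor (a + 2 * int M + 4 * int i) \<in> loc P" for i
  proof (rule qfactor_quotient_loc)
    assume "int M dvd a + 2 * int M + 4 * int i"
    then have "int M dvd (a + 2 * int M + 4 * int i) - int M * 2" by (rule dvd_diff) simp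
    then show "int M dvd a + 4 * int i" by (simp add: algebra_simps)
  qed (use assms M_pos in auto)
  moreover have "inverse (qfactors (a + 2) m) \<in> loc P" using assms(3) by (intro inverse_qfactors_loc)
  ultimately show ?thesis
    using assms(4) by (simp only: loc_mult_ideal loc_mult loc_prod)
qed

end

section \<open>Summands of the theorem and their decomposition into blocks\<close>

definition main_term :: "nat \<Rightarrow> ratfun" where
  "main_term k = (1 + qvar ^ (4 * k + 1)) * qfactors 2 k ^ 3 / ((1 + qvar) * qfactors 4 k ^ 3) * qvar ^ k"

lemma sum_lessThan_add: "(\<Sum>k<a + b. f k) = (\<Sum>k<a. f k) + (\<Sum>s<b. f (a + s))"
  for f :: "nat \<Rightarrow> 'a::comm_monoid_add"
  by (induction b) (simp_all add: add.assoc)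

text \<open>\<open>m_pos\<close> excludes \<open>M = 1\<close>, so that \<open>M\<close> does not
  divide 2 and \<open>1 + qvar\<close> is invertible in \<open>loc P\<close>.\<close>

locale odd_cyclotomic_loc = cyclotomic_loc +
  fixes m :: nat
  assumes M_eq: "M = 2 * m + 1" and m_pos: "m > 0"
begin

lemma M_dvd_cancel_2: "int M dvd 2 * x \<longleftrightarrow> int M dvd x"
proof -
  have "coprime (int M) 2" using M_eq by (simp add: coprime_right_2_iff_odd)
  then show ?thesis by (simp add: coprime_dvd_mult_right_iff)
qed

lemma not_M_dvd_4: 
  assumes "i + 1 < M" "int M dvd L"
  shows "\<not> int M dvd 4 + L + 4 * int i"
proof
  assume "int M dvd 4 + L + 4 * int i"
  then have "int M dvd (4 + L + 4 * int i) - L" using assms(2) by (rule dvd_diff)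
  then have "int M dvd 2 * (2 * int (i + 1))" by (simp add: algebra_simps)
  then have "int M dvd int (i + 1)" unfolding M_dvd_cancel_2 .
  then have "M dvd i + 1" by (simp only: int_dvd_int_iff)
  then show False using assms(1) by (auto dest: dvd_imp_le)
qed

text \<open>\<open>5 + 4 * i\<close> is less than \<open>2 * M\<close>, so \<open>M\<close> could
  divide it only by being equal to it, but it is 1 modulo 4 and \<open>M\<close> is 3. This keeps
  the denominators of the closed forms invertible.\<close>

lemma not_M_dvd_5:
  assumes "[M = 3] (mod 4)" "i < m" "int M dvd L"
  shows "\<not> int M dvd 5 + L + 4 * int i"
proof
  assume "int M dvd 5 + L + 4 * int i"
  then have "int M dvd (5 + L + 4 * int i) - L" using assms(3) by (rule dvd_diff)
  then have "int M dvd int (5 + 4 * i)" by (simp add: algebra_simps)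
  then have "M dvd 5 + 4 * i" by (simp only: int_dvd_int_iff)
  then obtain c where c: "5 + 4 * i = M * c" by auto
  have "M * c < M * 2" using c assms(2) M_eq by simp
  then have "c < 2" by simp
  moreover have "c \<noteq> 0" using c by (intro notI) simp
  ultimately have "c = 1" by simp
  then show False using c assms(1) unfolding cong_def by presburger
qed

text \<open>In each block, numerator and denominator both contain an exponent divisible by
  \<open>M\<close>; these factors cancel in pairs.\<close>

lemma qfactors_2_4_loc: "qfactors 2 (M * l) / qfactors 4 (M * l) \<in> loc P"
proof (cases "l = 0")
  case True
  then show ?thesis by (simp add: loc_1)
next
  case False
  \<comment> \<open>The witness is \<open>M * (l - 1) + m + 1\<close>; splitting off the last
    \<open>m\<close> factors fits \<open>qfactors_quotient_ideal\<close>, used here with exponent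
    0.\<close>
  then obtain k where k: "M * l = k + m" using M_eq by (cases l) (auto intro: that[of "M * (l - 1) + m + 1"])
  have "qfactors 2 (k + m) / qfactors (2 + 2) (k + m) \<in> ideal P 0"
  proof (rule qfactors_quotient_ideal[OF M_eq])
    show "\<not> int M dvd 2 + 2 + 4 * int i" if "i < m" for i
      using not_M_dvd_4[of i 0] that M_eq by simp
  qed (simp_all add: ideal_zero_eq_loc qfactors_loc)
  then show ?thesis by (simp add: k ideal_zero_eq_loc)
qed

text \<open>What is left of \<open>main_term (M * l + s)\<close> once the factor
  \<open>block_coeff l\<close>, independent of \<open>s\<close>, is split off.\<close>

definition block_term :: "nat \<Rightarrow> nat \<Rightarrow> ratfun" where
  "block_term l s = (1 + qvar powi (4 * int (M * l) + 1 + 4 * int s)) *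
     (qfactors (2 + 4 * int (M * l)) s ^ 3 * inverse (qfactors (4 + 4 * int (M * l)) s ^ 3)) * qvar ^ s"

text \<open>From \<open>s = m + 1\<close> on, the numerator product contains the factor of index
  \<open>m\<close>, whose exponent is \<open>M * (2 + 4 * l)\<close>, while the denominators remain
  invertible up to \<open>s < M\<close>.\<close>

lemma block_term_ideal:
  assumes "m < s" "s < M"
  shows "block_term l s \<in> ideal P 2"
proof -
  let ?L = "4 * int (M * l)"
  have "qfactors (2 + ?L) s \<in> ideal P 1"
  proof (rule qfactors_ideal[OF assms(1)])
    have "2 + ?L + 4 * int m = int M * (2 + 4 * int l)" using M_eq by (simp add: algebra_simps)
    then show "int M dvd 2 + ?L + 4 * int m" by simp
  qed
  then have "qfactors (2 + ?L) s * qfactors (2 + ?L) s \<in> ideal P (1 + 1)" by (intro ideal_mult)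
  then have "qfactors (2 + ?L) s ^ 3 \<in> ideal P 2"
    using ideal_mult_loc[OF _ qfactors_loc, of "qfactors (2 + ?L) s * qfactors (2 + ?L) s" 2 "2 + ?L" s]
    by (simp add: power3_eq_cube numeral_2_eq_2)
  moreover have "inverse (qfactors (4 + ?L) s ^ 3) \<in> loc P"
    unfolding power_inverse[symmetric] using assms by (intro loc_power inverse_qfactors_loc not_M_dvd_4) auto
  ultimately show ?thesis
    unfolding block_term_def by (intro ideal_mult_loc power_loc loc_mult_ideal[of "1 + _"] loc_add loc_1 powi_loc)
qed

text \<open>The numerator shifts \<open>L\<close>, \<open>- 2 * M - L\<close>, \<open>2 * M\<close>
  add up to 0, and the denominator shifts are their negatives. Hence each numerator exponent and its
  partner add up to \<open>6 + 2 * L\<close>, as a well-poised series requires.\<close>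

lemma block_quotient_cong2:
  assumes "s \<le> m" "int M dvd L"
  shows "cong2 (qfactors (2 + L) s ^ 3 * inverse (qfactors (4 + L) s ^ 3))
    (qfactors (2 + 2 * L) s * qfactors (2 - 2 * int M) s * qfactors (2 + 2 * int M + L) s *
      inverse (qfactors 4 s * qfactors (4 + 2 * int M + 2 * L) s * qfactors (4 - 2 * int M + L) s))"
proof (rule cong2_mult)
  have "cong2 (qfactors (2 + L) s ^ 3) (qfactors (2 + L + L) s * qfactors (2 + L + (- 2 * int M - L)) s * qfactors (2 + L + 2 * int M) s)"
    using assms by (intro qfactors_cube_cong2) auto
  then show "cong2 (qfactors (2 + L) s ^ 3) (qfactors (2 + 2 * L) s * qfactors (2 - 2 * int M) s * qfactors (2 + 2 * int M + L) s)"
    by (simp add: algebra_simps)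
  have inv: "inverse (qfactors (4 + L') s) \<in> loc P" if "int M dvd L'" for L'
    using that assms M_eq by (intro inverse_qfactors_loc not_M_dvd_4) auto
  have nz: "qfactors (4 + L') s \<noteq> 0" if "int M dvd L'" for L'
  proof (rule qfactors_nonzero)
    fix i assume "i < s"
    then have "\<not> int M dvd 4 + L' + 4 * int i" using that assms M_eq by (intro not_M_dvd_4) auto
    then show "4 + L' + 4 * int i \<noteq> 0" by (metis dvd_0_right)
  qed
  have "cong2 (qfactors (4 + L) s ^ 3) (qfactors (4 + L + (- L)) s * qfactors (4 + L + (2 * int M + L)) s * qfactors (4 + L + (- 2 * int M)) s)"
    using assms by (intro qfactors_cube_cong2) auto
  then have "cong2 (qfactors (4 + L) s ^ 3) (qfactors 4 s * qfactors (4 + 2 * int M + 2 * L) s * qfactors (4 - 2 * int M + L) s)"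
    by (simp add: algebra_simps)
  moreover have "inverse (qfactors (4 + L) s ^ 3) \<in> loc P"
    unfolding power_inverse[symmetric] using inv[OF assms(2)] by (rule loc_power)
  moreover have "inverse (qfactors 4 s * qfactors (4 + 2 * int M + 2 * L) s * qfactors (4 - 2 * int M + L) s) \<in> loc P"
    using inv[of 0] inv[of "2 * int M + 2 * L"] inv[of "- 2 * int M + L"] assms(2)
    by (auto simp: algebra_simps intro!: loc_mult)
  moreover have "qfactors (4 + L) s ^ 3 \<noteq> 0" "qfactors 4 s * qfactors (4 + 2 * int M + 2 * L) s * qfactors (4 - 2 * int M + L) s \<noteq> 0"
    using nz[OF assms(2)] nz[of 0] nz[of "2 * int M + 2 * L"] nz[of "- 2 * int M + L"] assms(2)
    by (auto simp: algebra_simps)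
  ultimately show "cong2 (inverse (qfactors (4 + L) s ^ 3))
      (inverse (qfactors 4 s * qfactors (4 + 2 * int M + 2 * L) s * qfactors (4 - 2 * int M + L) s))"
    by (intro cong2_inverse)
qed

text \<open>Replacing the summands one by one by \<open>block_quotient_cong2\<close> gives the
  series summed in \<open>terminating_block_sum\<close>.\<close>

lemma half_block_sum_cong:
  fixes l :: nat
  defines "L \<equiv> 4 * int (M * l)"
  shows "(\<Sum>s\<le>m. block_term l s) - (1 + qvar powi (L + 1)) *
      (qfactors (6 + 2 * L) m * qfactors (3 - 2 * int M) m / (qfactors (5 + L) m * qfactors (4 - 2 * int M + L) m)) \<in> ideal P 2"
proof -
  have L: "L \<ge> 0" "4 dvd L" "int M dvd L" by (auto simp: L_def)
  have "block_term l s - (1 + qvar powi (L + 1 + 4 * int s)) *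
      (qfactors (2 + 2 * L) s * qfactors (2 - 2 * int M) s * qfactors (2 + 2 * int M + L) s) /
      (qfactors 4 s * qfactors (4 + 2 * int M + 2 * L) s * qfactors (4 - 2 * int M + L) s) * qvar ^ s \<in> ideal P 2"
    (is "?d \<in> _") if "s \<le> m" for s
  proof -
    have "?d = (1 + qvar powi (L + 1 + 4 * int s)) * 
      (qfactors (2 + L) s ^ 3 * inverse (qfactors (4 + L) s ^ 3) - 
      (qfactors (2 + 2 * L) s * qfactors (2 - 2 * int M) s * qfactors (2 + 2 * int M + L) s *
      inverse (qfactors 4 s * qfactors (4 + 2 * int M + 2 * L) s * qfactors (4 - 2 * int M + L) s))) * qvar ^ s"
      unfolding block_term_def L_def[symmetric] divide_inverse
      by (simp only: right_diff_distrib left_diff_distrib mult.assoc)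
    moreover have "\<dots> \<in> ideal P 2"
      using block_quotient_cong2[OF that L(3)] unfolding cong2_def
      by (intro ideal_mult_loc power_loc loc_mult_ideal[of "1 + _"] loc_add loc_1 powi_loc) auto
    ultimately show ?thesis by simp
  qed
  then show ?thesis unfolding terminating_block_sum[OF M_eq L(1,2), symmetric] sum_subtractf[symmetric]
    by (intro ideal_sum) auto
qed

text \<open>Each of the two numerator products of the closed form contributes one factor
  \<open>cyclotomic M\<close>, and the denominators are invertible.\<close>

lemma half_block_sum_ideal:
  assumes "[M = 3] (mod 4)"
  shows "(\<Sum>s\<le>m. block_term l s) \<in> ideal P 2"
proof -
  define L where "L = 4 * int (M * l)"
  have L: "int M dvd L" by (auto simp: L_def)
  have M3: "M mod 4 = 3" using assms by (simp add: cong_def)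
  have "qfactors (6 + 2 * L) m \<in> ideal P 1"
  \<comment> \<open>The last exponent is \<open>2 * L + 2 * M\<close>.\<close>
  proof (rule qfactors_ideal[of "m - 1"])
    have "6 + 2 * L + 4 * int (m - 1) = L * 2 + int M * 2" using M_eq m_pos by (simp add: of_nat_diff)
    moreover have "int M dvd L * 2 + int M * 2" using L by (intro dvd_add dvd_mult2) simp_all
    ultimately show "int M dvd 6 + 2 * L + 4 * int (m - 1)" by (simp only:)
  qed (use m_pos in simp)
  moreover have "qfactors (3 - 2 * int M) m \<in> ideal P 1"
  \<comment> \<open>As \<open>M\<close> is 3 modulo 4, the exponent \<open>- M\<close> occurs in
    this product, at index \<open>(M - 3) / 4\<close>.\<close>
  proof (rule qfactors_ideal[of "M div 4"])
    have "M = 4 * (M div 4) + 3" using M3 by presburger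
    then have "3 - 2 * int M + 4 * int (M div 4) = - int M" by linarith
    then show "int M dvd 3 - 2 * int M + 4 * int (M div 4)" by (simp only: dvd_minus_iff dvd_refl)
    show "M div 4 < m" using M_eq M3 by presburger
  qed
  ultimately have "qfactors (6 + 2 * L) m * qfactors (3 - 2 * int M) m \<in> ideal P (1 + 1)" by (rule ideal_mult)
  moreover have "inverse (qfactors (5 + L) m) \<in> loc P"
  proof (rule inverse_qfactors_loc)
    fix i assume i: "i < m"
    show "\<not> int M dvd 5 + L + 4 * int i"
      using not_M_dvd_5[OF assms i L] .
  qed
  moreover have "inverse (qfactors (4 + (L - 2 * int M)) m) \<in> loc P"
  proof (intro inverse_qfactors_loc not_M_dvd_4)
    show "int M dvd L - 2 * int M" using L by (intro dvd_diff dvd_mult) auto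
  qed (use M_eq in auto)
  ultimately have "(1 + qvar powi (L + 1)) *
      (qfactors (6 + 2 * L) m * qfactors (3 - 2 * int M) m / (qfactors (5 + L) m * qfactors (4 - 2 * int M + L) m)) \<in> ideal P 2"
    unfolding divide_inverse inverse_mult_distrib
    by (intro loc_mult_ideal[of "1 + _"] loc_add loc_1 powi_loc ideal_mult_loc[of "_ * _"] loc_mult[of "inverse _"])
      (auto simp: algebra_simps numeral_2_eq_2)
  from ideal_add[OF half_block_sum_cong[of l] this[unfolded L_def]] show ?thesis
    by (simp only: diff_add_cancel)
qed

definition block_coeff :: "nat \<Rightarrow> ratfun" where
  "block_coeff l = inverse (1 + qvar) * (qfactors 2 (M * l) / qfactors 4 (M * l)) ^ 3 * qvar ^ (M * l)"

lemma inverse_one_plus_qvar_loc: "inverse (1 + qvar) \<in> loc P"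
proof -
  have "\<not> int M dvd 2" using M_eq m_pos by (auto dest!: zdvd_imp_le)
  then have "qfactor 1 * inverse (qfactor 2) \<in> loc P" by (intro loc_mult qfactor_loc inverse_qfactor_loc)
  moreover have "inverse (1 + qvar) = qfactor 1 * inverse (qfactor 2)"
    using one_plus_qvar_powi[of 1] by (simp add: divide_inverse mult.commute)
  ultimately show ?thesis by simp
qed

lemma block_coeff_loc: "block_coeff l \<in> loc P"
  unfolding block_coeff_def
  by (intro loc_mult loc_power power_loc inverse_one_plus_qvar_loc qfactors_2_4_loc)

lemma main_term_block: "main_term (M * l + s) = block_coeff l * block_term l s"
proof -
  have "qvar powi (4 * int (M * l) + 1 + 4 * int s) = qvar powi int (4 * (M * l + s) + 1)"
    by (simp add: algebra_simps)
  then have "qvar powi (4 * int (M * l) + 1 + 4 * int s) = qvar ^ (4 * (M * l + s) + 1)"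
    by (simp only: power_int_of_nat)
  then show ?thesis
    unfolding main_term_def block_coeff_def block_term_def qfactors_add power_add[of qvar "M * l" s] 
    by (simp add: divide_inverse power_mult_distrib power_inverse mult_ac)
qed

lemma half_block_main_sum: "(\<Sum>s\<le>m. main_term (M * l + s)) = block_coeff l * (\<Sum>s\<le>m. block_term l s)"
  by (simp add: main_term_block sum_distrib_left)

lemma block_rest_ideal: "(\<Sum>s\<in>{m<..<M}. main_term (M * l + s)) \<in> ideal P 2"
  unfolding main_term_block
  by (intro ideal_sum loc_mult_ideal block_coeff_loc block_term_ideal) auto

lemma full_block_main_sum:
  "(\<Sum>s<M. main_term (M * l + s)) = (\<Sum>s\<le>m. main_term (M * l + s)) + (\<Sum>s\<in>{m<..<M}. main_term (M * l + s))"
proof -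
  have "{..<M} = {..m} \<union> {m<..<M}" using M_eq by auto
  then show ?thesis by (simp add: sum.union_disjoint disjoint_iff)
qed

text \<open>Every full block vanishes modulo \<open>P ^ 2\<close>, and so does the first half of a
  block; the first sum ends exactly after such a half.\<close>

lemma main_sum_ideal:
  assumes "[M = 3] (mod 4)"
  shows "(\<Sum>k\<le>M * h + m. main_term k) \<in> ideal P 2" "(\<Sum>k<M * h. main_term k) \<in> ideal P 2"
proof -
  have half: "(\<Sum>s\<le>m. main_term (M * l + s)) \<in> ideal P 2" for l
    unfolding half_block_main_sum by (intro loc_mult_ideal block_coeff_loc half_block_sum_ideal assms)
  then have full: "(\<Sum>s<M. main_term (M * l + s)) \<in> ideal P 2" for l
    unfolding full_block_main_sum by (intro ideal_add block_rest_ideal)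
  have blocks: "(\<Sum>k<M * h. main_term k) = (\<Sum>l<h. \<Sum>s<M. main_term (M * l + s))"
  proof (induction h)
    case (Suc h)
    then show ?case using sum_lessThan_add[of main_term "M * h" M] by (simp add: add.commute)
  qed simp
  then show 1: "(\<Sum>k<M * h. main_term k) \<in> ideal P 2" by (simp add: ideal_sum full)
  have "(\<Sum>k\<le>M * h + m. main_term k) = (\<Sum>k<M * h. main_term k) + (\<Sum>s\<le>m. main_term (M * h + s))"
    using sum_lessThan_add[of main_term "M * h" "Suc m"] by (simp add: lessThan_Suc_atMost)
  then show "(\<Sum>k\<le>M * h + m. main_term k) \<in> ideal P 2" using 1 half by (simp add: ideal_add)
qed

text \<open>One factor \<open>cyclotomic M\<close> comes from the q-integer. The other comes from
  the last \<open>m\<close> factors of \<open>qfactors 3 (M * h + m)\<close>, which remain after the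
  pairing with the denominator and include the exponent \<open>M * (1 + 4 * h)\<close>.\<close>

lemma rhs_ideal:
  assumes "[M = 3] (mod 4)"
  shows "qint (qvar ^ 2) (M * c) * qfactors 3 (M * h + m) / qfactors 5 (M * h + m) * qvar powi x \<in> ideal P 2"
proof -
  have M3: "M mod 4 = 3" using assms by (simp add: cong_def)
  have "\<not> int M dvd 2" using M_eq m_pos by (auto dest!: zdvd_imp_le)
  then have "qint (qvar ^ 2) (M * c) \<in> ideal P 1"
    unfolding qint_qvar_square divide_inverse by (intro ideal_mult_loc qfactor_ideal inverse_qfactor_loc) auto
  moreover have "qfactors 3 (M * h + m) / qfactors (3 + 2) (M * h + m) \<in> ideal P 1"
  proof (rule qfactors_quotient_ideal[OF M_eq])
    fix i assume i: "i < m"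
    show "\<not> int M dvd 3 + 2 + 4 * int i"
      using not_M_dvd_5[OF assms i, of 0] by simp
  next
    have "M = 4 * (M div 4) + 3" using M3 by presburger
    then have "3 + 4 * int (M * h) + 4 * int (M div 4) = int M * (1 + 4 * int h)"
      by (simp add: algebra_simps)
    then have "int M dvd 3 + 4 * int (M * h) + 4 * int (M div 4)" by simp
    moreover have "M div 4 < m" using M_eq M3 by presburger
    ultimately show "qfactors (3 + 4 * int (M * h)) m \<in> ideal P 1" by (intro qfactors_ideal)
  qed simp
  ultimately have "qint (qvar ^ 2) (M * c) * (qfactors 3 (M * h + m) / qfactors (3 + 2) (M * h + m)) \<in> ideal P (1 + 1)"
    by (rule ideal_mult)
  then have "qint (qvar ^ 2) (M * c) * (qfactors 3 (M * h + m) / qfactors (3 + 2) (M * h + m)) * qvar powi x \<in> ideal P 2"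
    using ideal_mult_loc[OF _ powi_loc] by (simp only: one_add_one)
  then show ?thesis by simp
qed

text \<open>Here the half range is the block \<open>l = 0\<close>, whose coefficient is
  \<open>1 / (1 + qvar)\<close> and whose closed form is \<open>(1 + qvar) * R\<close> by
  \<open>closed_form_reflect\<close>. The upper half of the full range vanishes modulo
  \<open>P ^ 2\<close>.\<close>

lemma main_sum_cong_top:
  defines "R \<equiv> qint (qvar ^ 2) M * qfactors 3 m / qfactors 5 m * qvar powi (- int m)"
  shows "(\<Sum>k\<le>m. main_term k) - R \<in> ideal P 2" "(\<Sum>k<M. main_term k) - R \<in> ideal P 2"
proof -
  have nz: "1 + qvar \<noteq> 0" using one_plus_qvar_powi[of 1] by (simp add: qfactor_nonzero)
  have c: "block_coeff 0 * (1 + qvar) = 1" using nz by (simp add: block_coeff_def)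
  have "(\<Sum>s\<le>m. block_term 0 s) - (1 + qvar) * R \<in> ideal P 2"
    using half_block_sum_cong[of 0] closed_form_reflect[OF M_eq] by (simp add: R_def)
  then have "block_coeff 0 * ((\<Sum>s\<le>m. block_term 0 s) - (1 + qvar) * R) \<in> ideal P 2"
    by (intro loc_mult_ideal block_coeff_loc)
  also have "block_coeff 0 * ((\<Sum>s\<le>m. block_term 0 s) - (1 + qvar) * R) = (\<Sum>k\<le>m. main_term k) - R"
    using half_block_main_sum[of 0] c by (simp add: right_diff_distrib mult.assoc[symmetric])
  finally show 1: "(\<Sum>k\<le>m. main_term k) - R \<in> ideal P 2" .
  have "(\<Sum>k<M. main_term k) - R = ((\<Sum>k\<le>m. main_term k) - R) + (\<Sum>s\<in>{m<..<M}. main_term s)"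
    using full_block_main_sum[of 0] by simp
  also have "\<dots> \<in> ideal P 2"
    using 1 block_rest_ideal[of 0] by (intro ideal_add) simp_all
  finally show "(\<Sum>k<M. main_term k) - R \<in> ideal P 2" .
qed

end

section \<open>Combining the moduli\<close>

lemma main_term_eq:
  "(1 + qvar ^ (4 * k + 1)) * qpoch (qvar ^ 2) (qvar ^ 4) k ^ 3
     / ((1 + qvar) * qpoch (qvar ^ 4) (qvar ^ 4) k ^ 3) * qvar ^ k = main_term k"
  using qpoch_powi[of 2 k] qpoch_powi[of 4 k] by (simp add: main_term_def)

lemma odd_power_mod_4:
  fixes n :: nat
  assumes "[n = 3] (mod 4)"
  shows "[n ^ (2 * j + 1) = 3] (mod 4)"
proof (induction j)
  case (Suc j)
  have "[n ^ (2 * j + 1) * (n * n) = 3 * (3 * 3)] (mod 4)"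
    by (intro cong_mult Suc assms)
  then show ?case by (simp add: cong_def mult_ac)
qed (use assms in simp)

text \<open>Both sides vanish separately modulo the square of \<open>cyclotomic M\<close>.\<close>

lemma main_sum_cong_lower:
  fixes M N h c :: nat
  assumes M3: "[M = 3] (mod 4)" and N: "N = M * c" "N = 2 * h + 1"
  defines "R \<equiv> qint (qvar ^ 2) N * qfactors 3 h / qfactors 5 h * qvar powi (- int h)"
  shows "(\<Sum>k\<le>h. main_term k) - R \<in> ideal (cyclotomic M) 2"
    and "(\<Sum>k<N. main_term k) - R \<in> ideal (cyclotomic M) 2"
proof -
  define m where "m = (M - 1) div 2"
  have m: "M = 2 * m + 1" "m > 0" using M3 unfolding m_def cong_def by presburger+
  interpret odd_cyclotomic_loc M m using m by unfold_locales auto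
  have "odd N" using N(2) by simp
  then have "odd c" unfolding N(1) by simp
  \<comment> \<open>Because the cofactor \<open>c = 2 * g + 1\<close> is odd, the half range
    consists of \<open>g\<close> full blocks and the first half of the next one.\<close>
  then obtain g where g: "c = 2 * g + 1" by (elim oddE)
  have h: "h = M * g + m"
    using N m g by (simp add: algebra_simps)
  have "R \<in> ideal P 2" unfolding R_def N(1) h by (rule rhs_ideal[OF M3])
  then show "(\<Sum>k\<le>h. main_term k) - R \<in> ideal P 2" "(\<Sum>k<N. main_term k) - R \<in> ideal P 2"
    unfolding h N(1) by (intro ideal_diff main_sum_ideal[OF M3]; assumption)+
qed

lemma ratfun_cong_cyclotomic_powers:
  assumes n: "n \<ge> 2" and top: "A - B \<in> ideal (cyclotomic (n ^ (2 * r))) 2"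
    and lower: "\<And>j. 1 \<le> j \<Longrightarrow> j \<le> r \<Longrightarrow> A - B \<in> ideal (cyclotomic (n ^ (2 * j - 1))) 2"
  shows "ratfun_cong A B (cyclotomic (n ^ (2 * r)) ^ 2 * (\<Prod>j = 1..r. cyclotomic (n ^ (2 * j - 1)) ^ 2))"
proof -
  let ?I = "(\<lambda>j. n ^ (2 * j - 1)) ` {1..r}"
  let ?D = "insert (n ^ (2 * r)) ?I"
  have inj: "n ^ a = n ^ b \<longleftrightarrow> a = b" for a b using n by (intro power_inject_exp) simp
  \<comment> \<open>An even exponent of \<open>n\<close> differs from every odd one, so the moduli
    are distinct cyclotomic polynomials.\<close>
  have notin: "n ^ (2 * r) \<notin> ?I"
  proof
    assume "n ^ (2 * r) \<in> ?I"
    then obtain j where "2 * r = 2 * j - 1" "1 \<le> j" by (auto simp: inj)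
    then show False by presburger
  qed
  have "(\<Prod>d\<in>?I. cyclotomic d ^ 2) = (\<Prod>j = 1..r. cyclotomic (n ^ (2 * j - 1)) ^ 2)"
    by (subst prod.reindex) (auto simp: inj_on_def inj)
  then have eq: "(\<Prod>d\<in>?D. cyclotomic d ^ 2) =
      cyclotomic (n ^ (2 * r)) ^ 2 * (\<Prod>j = 1..r. cyclotomic (n ^ (2 * j - 1)) ^ 2)"
    using notin by simp
  have pos: "d > 0" if "d \<in> ?D" for d using that n by auto
  have "ratfun_cong A B (\<Prod>d\<in>?D. cyclotomic d ^ 2)"
    by (intro ratfun_cong_prodI coprime_cyclotomic pos) (use top lower in auto)
  then show ?thesis unfolding eq .
qed

text \<open>The odd powers of \<open>n\<close> are 3 modulo 4 and fall under
  \<open>main_sum_cong_lower\<close>; the even power \<open>N\<close> is treated by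
  \<open>main_sum_cong_top\<close>.\<close>

lemma main_congruence:
  fixes n r N h :: nat
  assumes r: "r > 0" and n3: "[n = 3] (mod 4)" and N: "N = n ^ (2 * r)" "N = 2 * h + 1"
  defines "R \<equiv> qint (qvar ^ 2) N * qfactors 3 h / qfactors 5 h * qvar powi (- int h)"
    and "Q \<equiv> cyclotomic (n ^ (2 * r)) ^ 2 * (\<Prod>j = 1..r. cyclotomic (n ^ (2 * j - 1)) ^ 2)"
  shows "ratfun_cong (\<Sum>k\<le>h. main_term k) R Q" and "ratfun_cong (\<Sum>k<N. main_term k) R Q"
proof -
  have n: "n \<ge> 3" using n3 by (cases "n < 3") (auto simp: cong_def)
  have "n \<le> N" unfolding N(1) using n r by (intro self_le_power) auto
  then interpret odd_cyclotomic_loc N h using N(2) n by unfold_locales auto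
  have lower: "(\<Sum>k\<le>h. main_term k) - R \<in> ideal (cyclotomic (n ^ (2 * j - 1))) 2"
    "(\<Sum>k<N. main_term k) - R \<in> ideal (cyclotomic (n ^ (2 * j - 1))) 2" if j: "1 \<le> j" "j \<le> r" for j
  proof -
    obtain i where "j = Suc i" using j(1) by (cases j) auto
    then have "[n ^ (2 * j - 1) = 3] (mod 4)" using odd_power_mod_4[OF n3, of i] by simp
    \<comment> \<open>The cofactor exponent is written with \<open>+ 1\<close> first so that the
      truncated subtraction is exact for \<open>j \<le> r\<close>.\<close>
    moreover have "N = n ^ (2 * j - 1) * n ^ (2 * r + 1 - 2 * j)"
      unfolding N(1) power_add[symmetric] using j by simp
    ultimately show "(\<Sum>k\<le>h. main_term k) - R \<in> ideal (cyclotomic (n ^ (2 * j - 1))) 2"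
      "(\<Sum>k<N. main_term k) - R \<in> ideal (cyclotomic (n ^ (2 * j - 1))) 2"
      unfolding R_def using N(2) by (rule main_sum_cong_lower)+
  qed
  show "ratfun_cong (\<Sum>k\<le>h. main_term k) R Q" "ratfun_cong (\<Sum>k<N. main_term k) R Q"
    unfolding Q_def using n lower main_sum_cong_top[folded R_def]
    by (intro ratfun_cong_cyclotomic_powers; simp add: N(1))+
qed

theorem theorem4p1:
  fixes n r :: nat
  assumes "n > 0" and "r > 0" and "[n = 3] (mod 4)"
  shows
    "ratfun_cong
       (\<Sum>k = 0..(n ^ (2 * r) - 1) div 2.
          (1 + qvar ^ (4 * k + 1)) * qpoch (qvar ^ 2) (qvar ^ 4) k ^ 3
            / ((1 + qvar) * qpoch (qvar ^ 4) (qvar ^ 4) k ^ 3) * qvar ^ k)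
       (qint (qvar ^ 2) (n ^ (2 * r)) * qpoch (qvar ^ 3) (qvar ^ 4) ((n ^ (2 * r) - 1) div 2)
          / qpoch (qvar ^ 5) (qvar ^ 4) ((n ^ (2 * r) - 1) div 2)
          * qvar powi ((1 - int (n ^ (2 * r))) div 2))
       (cyclotomic (n ^ (2 * r)) ^ 2 * (\<Prod>j = 1..r. cyclotomic (n ^ (2 * j - 1)) ^ 2))
   \<and> ratfun_cong
       (\<Sum>k = 0..n ^ (2 * r) - 1.
          (1 + qvar ^ (4 * k + 1)) * qpoch (qvar ^ 2) (qvar ^ 4) k ^ 3
            / ((1 + qvar) * qpoch (qvar ^ 4) (qvar ^ 4) k ^ 3) * qvar ^ k)
       (qint (qvar ^ 2) (n ^ (2 * r)) * qpoch (qvar ^ 3) (qvar ^ 4) ((n ^ (2 * r) - 1) div 2)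
          / qpoch (qvar ^ 5) (qvar ^ 4) ((n ^ (2 * r) - 1) div 2)
          * qvar powi ((1 - int (n ^ (2 * r))) div 2))
       (cyclotomic (n ^ (2 * r)) ^ 2 * (\<Prod>j = 1..r. cyclotomic (n ^ (2 * j - 1)) ^ 2))"
proof -
  define N h where "N = n ^ (2 * r)" and "h = (n ^ (2 * r) - 1) div 2"
  have "odd n" using assms(3) unfolding cong_def by presburger
  then have "odd N" by (simp add: N_def)
  then have N: "N = 2 * h + 1" by (simp add: N_def h_def)
  \<comment> \<open>The integer division is exact, since
    \<open>1 - int N = - 2 * int h\<close>.\<close>
  have e: "(1 - int N) div 2 = - int h" using N by simp
  have s: "{0..h} = {..h}" "{0..N - 1} = {..<N}" using N by auto
  have p: "qpoch (qvar ^ 3) (qvar ^ 4) h = qfactors 3 h" "qpoch (qvar ^ 5) (qvar ^ 4) h = qfactors 5 h"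
    using qpoch_powi[of 3 h] qpoch_powi[of 5 h] by simp_all
  show ?thesis
    using main_congruence[OF assms(2,3) N_def N]
    unfolding main_term_eq h_def[symmetric] unfolding N_def[symmetric] s e p by simp
qed

end
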